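(* Let $n$ be a positive integer. Every subgroup $\Delta$ of finite index $n$ in $\pi_1(\mathcal{B}_2)$ is isomorphic to either $\mathbb{Z}^3$, or $\pi_1(\mathcal{B}_2)$, or $\pi_1(\mathcal{B}_1)$, and the numbers of subgroups of index $n$ of each type are $$\text{(i)}\quad s_{\mathbb{Z}^3,\pi_1(\mathcal{B}_2)}(n)=\sum_{2l\mid n}\sigma_1(l)\,l,$$ $$\text{(ii)}\quad s_{\pi_1(\mathcal{B}_2),\pi_1(\mathcal{B}_2)}(n)=\begin{cases}\displaystyle\sum_{4k\mid n}2k\Big(\sigma_1\!\left(\frac n{2k}\right)-\sigma_1\!\left(\frac n{4k}\right)\Big)&\text{if } n\text{ is even},\\[2ex]\displaystyle\sum_{k\mid n}\sigma_1\!\left(\frac nk\right)k&\text{if } n\text{ is odd},\end{cases}$$ $$\text{(iii)}\quad s_{\pi_1(\mathcal{B}_1),\pi_1(\mathcal{B}_2)}(n)=\sum_{2k\mid n}2k\,\sigma_1\!\left(\frac n{2k}\right)-\sum_{4k\mid n}2k\,\sigma_1\!\left(\frac n{4k}\right).$$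
   Context: $\pi_1(\mathcal{B}_1)=\langle a,b,c : cac^{-1}a^{-1}=cbc^{-1}b^{-1}=1,\ aba^{-1}b=1\rangle$ and $\pi_1(\mathcal{B}_2)=\langle \alpha,\beta,\gamma : \gamma\beta\gamma^{-1}=\alpha\gamma\alpha^{-1}\gamma^{-1}=\beta,\ \alpha\beta\alpha^{-1}=\beta^{-1}\rangle$ are the fundamental groups of the non-orientable closed flat 3-manifolds $\mathcal{B}_1$ and $\mathcal{B}_2$ (first and second amphicosm). For groups $H,G$, $s_{H,G}(n)$ denotes the number of subgroups of index $n$ in $G$ that are isomorphic to $H$. $\sigma_1(m)=\sum_{k\mid m}k$ is the sum of positive divisors of the positive integer $m$. A sum $\sum_{jk\mid n}$ (with $j$ a fixed integer) runs over all positive integers $k$ such that $jk$ divides $n$, and equals $0$ if there are none. *)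

theory Defs
  imports "HOL-Algebra.Elementary_Groups"
begin

text \<open>A letter \<open>(x, True)\<close> is the generator \<open>x\<close>, and \<open>(x, False)\<close> is its formal inverse.\<close>

type_synonym 'g word = "('g \<times> bool) list"

abbreviation gen :: "'g \<Rightarrow> 'g \<times> bool"
  where "gen x \<equiv> (x, True)"

abbreviation gen_inv :: "'g \<Rightarrow> 'g \<times> bool"
  where "gen_inv x \<equiv> (x, False)"

text \<open>The congruence on words generated by free cancellation and by the relations
  \<open>l = r\<close> for \<open>(l, r) \<in> R\<close>.\<close>

inductive word_eq :: "('g word \<times> 'g word) set \<Rightarrow> 'g word \<Rightarrow> 'g word \<Rightarrow> bool"
  for R :: "('g word \<times> 'g word) set"
  where
    refl: "word_eq R u u"
  | sym: "word_eq R u v \<Longrightarrow> word_eq R v u"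
  | trans: "word_eq R u v \<Longrightarrow> word_eq R v w \<Longrightarrow> word_eq R u w"
  | cancel: "word_eq R (u @ [(x, e), (x, \<not> e)] @ v) (u @ v)"
  | relation: "(l, r) \<in> R \<Longrightarrow> word_eq R (u @ l @ v) (u @ r @ v)"

definition word_rel :: "('g word \<times> 'g word) set \<Rightarrow> ('g word \<times> 'g word) set"
  where "word_rel R = {(u, v). word_eq R u v}"

text \<open>The set of generators is the whole type \<open>'g\<close>.\<close>

definition presented_group :: "('g word \<times> 'g word) set \<Rightarrow> 'g word set monoid"
  where "presented_group R =
    \<lparr> carrier = UNIV // word_rel R,
      mult = (\<lambda>X Y. \<Union>u\<in>X. \<Union>v\<in>Y. word_rel R `` {u @ v}),
      one = word_rel R `` {[]} \<rparr>"

lemma equiv_word_rel: "equiv UNIV (word_rel R)"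
  by (rule equivI)
    (auto simp: word_rel_def refl_on_def sym_def trans_def intro: word_eq.intros)

lemma word_eq_append_left: "word_eq R u v \<Longrightarrow> word_eq R (w @ u) (w @ v)"
proof (induction rule: word_eq.induct)
  case (cancel u x e v)
  show ?case using word_eq.cancel[of R "w @ u" x e v] by simp
next
  case (relation l r u v)
  then show ?case using word_eq.relation[of l r R "w @ u" v] by simp
qed (auto intro: word_eq.intros)

lemma word_eq_append_right: "word_eq R u v \<Longrightarrow> word_eq R (u @ w) (v @ w)"
proof (induction rule: word_eq.induct)
  case (cancel u x e v)
  show ?case using word_eq.cancel[of R u x e "v @ w"] by simp
next
  case (relation l r u v)
  then show ?case using word_eq.relation[of l r R u "v @ w"] by simp
qed (auto intro: word_eq.intros)

lemma word_eq_append: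
  "word_eq R u u' \<Longrightarrow> word_eq R v v' \<Longrightarrow> word_eq R (u @ v) (u' @ v')"
  by (meson word_eq.trans word_eq_append_left word_eq_append_right)

lemma presented_group_mult:
  "word_rel R `` {u} \<otimes>\<^bsub>presented_group R\<^esub> word_rel R `` {v} = word_rel R `` {u @ v}"
proof -
  have "congruent2 (word_rel R) (word_rel R) (\<lambda>u v. word_rel R `` {u @ v})"
    by (rule congruent2I'[OF equiv_class_eq[OF equiv_word_rel]])
      (simp add: word_rel_def word_eq_append)
  then show ?thesis
    by (simp add: presented_group_def UN_equiv_class2[OF equiv_word_rel equiv_word_rel])
qed

lemma word_eq_inverse:
  "word_eq R (rev (map (\<lambda>(x, e). (x, \<not> e)) u) @ u) []"
proof (induction u)
  case Nil
  show ?case by (simp add: word_eq.refl)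
next
  case (Cons p u)
  obtain x e where "p = (x, e)" by (cases p)
  then show ?case
    using word_eq.cancel[of R "rev (map (\<lambda>(x, e). (x, \<not> e)) u)" x "\<not> e" u] Cons
    by (auto intro: word_eq.trans)
qed

lemma group_presented_group: "group (presented_group R)"
proof (rule groupI)
  let ?G = "presented_group R"
  have carr: "X \<in> carrier ?G \<longleftrightarrow> (\<exists>u. X = word_rel R `` {u})" for X
    by (auto simp: presented_group_def quotient_def)
  have one: "\<one>\<^bsub>?G\<^esub> = word_rel R `` {[]}"
    by (simp add: presented_group_def)
  show "X \<otimes>\<^bsub>?G\<^esub> Y \<in> carrier ?G" if "X \<in> carrier ?G" "Y \<in> carrier ?G" for X Y
    using that by (auto simp: carr presented_group_mult)
  show "\<one>\<^bsub>?G\<^esub> \<in> carrier ?G"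
    by (auto simp: carr one)
  show "X \<otimes>\<^bsub>?G\<^esub> Y \<otimes>\<^bsub>?G\<^esub> Z = X \<otimes>\<^bsub>?G\<^esub> (Y \<otimes>\<^bsub>?G\<^esub> Z)"
    if "X \<in> carrier ?G" "Y \<in> carrier ?G" "Z \<in> carrier ?G" for X Y Z
    using that by (auto simp: carr presented_group_mult)
  show "\<one>\<^bsub>?G\<^esub> \<otimes>\<^bsub>?G\<^esub> X = X" if "X \<in> carrier ?G" for X
    using that by (auto simp: carr one presented_group_mult)
  show "\<exists>Y\<in>carrier ?G. Y \<otimes>\<^bsub>?G\<^esub> X = \<one>\<^bsub>?G\<^esub>" if X: "X \<in> carrier ?G" for X
  proof -
    obtain u where u: "X = word_rel R `` {u}"
      using X by (auto simp: carr)
    let ?Y = "word_rel R `` {rev (map (\<lambda>(x, e). (x, \<not> e)) u)}"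
    have "?Y \<otimes>\<^bsub>?G\<^esub> X = \<one>\<^bsub>?G\<^esub>"
      unfolding u one presented_group_mult
      by (rule equiv_class_eq[OF equiv_word_rel]) (simp add: word_rel_def word_eq_inverse)
    moreover have "?Y \<in> carrier ?G"
      unfolding carr by blast
    ultimately show ?thesis by blast
  qed
qed

text \<open>\<open>pi1_B1\<close> and \<open>pi1_B2\<close> are the fundamental groups of the non-orientable closed flat
  3-manifolds known as the first and the second amphicosm.\<close>

datatype amphi1_gen = Gen_a | Gen_b | Gen_c

definition pi1_B1 :: "amphi1_gen word set monoid"
  where "pi1_B1 = presented_group
    {([gen Gen_c, gen Gen_a, gen_inv Gen_c, gen_inv Gen_a], []),
     ([gen Gen_c, gen Gen_b, gen_inv Gen_c, gen_inv Gen_b], []),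
     ([gen Gen_a, gen Gen_b, gen_inv Gen_a, gen Gen_b], [])}"

datatype amphi2_gen = Gen_alpha | Gen_beta | Gen_gamma

definition pi1_B2 :: "amphi2_gen word set monoid"
  where "pi1_B2 = presented_group
    {([gen Gen_gamma, gen Gen_beta, gen_inv Gen_gamma], [gen Gen_beta]),
     ([gen Gen_alpha, gen Gen_gamma, gen_inv Gen_alpha, gen_inv Gen_gamma], [gen Gen_beta]),
     ([gen Gen_alpha, gen Gen_beta, gen_inv Gen_alpha], [gen_inv Gen_beta])}"

definition Z3 :: "(int \<times> int \<times> int) monoid"
  where "Z3 = integer_group \<times>\<times> (integer_group \<times>\<times> integer_group)"

text \<open>An infinite family of cosets has \<open>card\<close> equal to 0, so for \<open>n > 0\<close> only subgroups of
  finite index \<open>n\<close> are collected.\<close>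

definition subgroups_of_index :: "('a, 'c) monoid_scheme \<Rightarrow> nat \<Rightarrow> 'a set set"
  where "subgroups_of_index G n = {\<Delta>. subgroup \<Delta> G \<and> card (rcosets\<^bsub>G\<^esub> \<Delta>) = n}"

definition num_subgroups :: "('b, 'd) monoid_scheme \<Rightarrow> ('a, 'c) monoid_scheme \<Rightarrow> nat \<Rightarrow> nat"
  where "num_subgroups H G n =
    card {\<Delta> \<in> subgroups_of_index G n. G\<lparr>carrier := \<Delta>\<rparr> \<cong> H}"

definition sigma1 :: "nat \<Rightarrow> nat"
  where "sigma1 m = (\<Sum>k | k dvd m. k)"

end

theory Submission
  imports Defs
begin

text \<open>Both groups are semidirect products of \<open>\<int>\<^sup>2\<close> by \<open>\<int>\<close>, the generator acting as a reflection
  of order 2: a diagonal one for \<open>B\<^sub>1\<close>, one that swaps two basis vectors for \<open>B\<^sub>2\<close>. A subgroup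
  \<open>\<Delta>\<close> of index \<open>n\<close> in \<open>\<pi>\<^sub>1(B\<^sub>2)\<close> is given by the image \<open>l \<int>\<close> of its projection to \<open>\<int>\<close>, the lattice
  \<open>L = \<Delta> \<inter> \<int>\<^sup>2\<close> of index \<open>n / l\<close>, spanned in Hermite normal form by \<open>(p, 0)\<close> and \<open>(q, r)\<close>, and a class in
  \<open>\<int>\<^sup>2 / L\<close> saying how the generator of \<open>l \<int>\<close> is lifted. If \<open>l\<close> is even, every \<open>L\<close> occurs and \<open>\<Delta>\<close> is
  abelian. If \<open>l\<close> is odd, \<open>L\<close> must be invariant under the reflection, that is \<open>r - 2 q = p t\<close>, and the
  parity of \<open>t\<close> tells which of the two reflections acts on \<open>L\<close>. For given \<open>p\<close> and \<open>r\<close> there is at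
  most one \<open>q\<close> with a prescribed parity of \<open>t\<close>, and it exists iff \<open>r - t p\<close> is even. All three counts
  become sums over the triples with \<open>l p r = n\<close>.\<close>

section \<open>Groups given by presentations\<close>

definition word_value :: "('a, 'c) monoid_scheme \<Rightarrow> ('g \<Rightarrow> 'a) \<Rightarrow> 'g word \<Rightarrow> 'a"
  where "word_value H f w =
    foldr (\<lambda>(x, e) t. (if e then f x else inv\<^bsub>H\<^esub> f x) \<otimes>\<^bsub>H\<^esub> t) w \<one>\<^bsub>H\<^esub>"

lemma word_value_simps [simp]:
  "word_value H f [] = \<one>\<^bsub>H\<^esub>"
  "word_value H f ((x, e) # w) = (if e then f x else inv\<^bsub>H\<^esub> f x) \<otimes>\<^bsub>H\<^esub> word_value H f w"
  by (simp_all add: word_value_def)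

context group
begin

lemma mult_inv_cancel_left:
  assumes "x \<in> carrier G" "y \<in> carrier G"
  shows "x \<otimes> (inv x \<otimes> y) = y" and "inv x \<otimes> (x \<otimes> y) = y"
  using assms by (simp_all add: m_assoc[symmetric])

lemma word_value_closed [simp]:
  assumes "\<And>x. f x \<in> carrier G"
  shows "word_value G f w \<in> carrier G"
  using assms by (induction w) auto

lemma word_value_append:
  assumes "\<And>x. f x \<in> carrier G"
  shows "word_value G f (u @ v) = word_value G f u \<otimes> word_value G f v"
  using assms by (induction u) (auto simp: m_assoc)

lemma word_value_word_eq:
  assumes f: "\<And>x. f x \<in> carrier G"
    and R: "\<And>l r. (l, r) \<in> R \<Longrightarrow> word_value G f l = word_value G f r"
    and "word_eq R u v"
  shows "word_value G f u = word_value G f v"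
  using assms(3)
  by (induction rule: word_eq.induct)
    (auto simp: word_value_append[OF f] f R mult_inv_cancel_left)

end

lemma presented_group_class_in_carrier [simp]: "word_rel R `` {w} \<in> carrier (presented_group R)"
  by (simp add: presented_group_def quotientI)

lemma presented_group_carrierE:
  assumes "X \<in> carrier (presented_group R)"
  obtains w where "X = word_rel R `` {w}"
  using assms by (auto simp: presented_group_def quotient_def)

lemma presented_group_one: "\<one>\<^bsub>presented_group R\<^esub> = word_rel R `` {[]}"
  by (simp add: presented_group_def)

lemma presented_group_class_eq: "word_eq R u v \<Longrightarrow> word_rel R `` {u} = word_rel R `` {v}"
  by (rule equiv_class_eq[OF equiv_word_rel]) (simp add: word_rel_def)

lemma presented_group_inv_gen:
  "inv\<^bsub>presented_group R\<^esub> (word_rel R `` {[gen x]}) = word_rel R `` {[gen_inv x]}"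
proof -
  interpret group "presented_group R" by (rule group_presented_group)
  have "word_eq R [gen_inv x, gen x] []"
    using word_eq.cancel[of R "[]" x False "[]"] by simp
  then show ?thesis
    by (intro inv_equality) (simp_all add: presented_group_mult presented_group_one presented_group_class_eq)
qed

lemma presented_group_word_value:
  "word_value (presented_group R) (\<lambda>x. word_rel R `` {[gen x]}) w = word_rel R `` {w}"
proof (induction w)
  case (Cons p w)
  then show ?case
    by (cases p) (auto simp: presented_group_inv_gen presented_group_mult)
qed (simp add: presented_group_one)

lemma presented_group_relation:
  assumes "(l, r) \<in> R"
  shows "word_value (presented_group R) (\<lambda>x. word_rel R `` {[gen x]}) l =
    word_value (presented_group R) (\<lambda>x. word_rel R `` {[gen x]}) r"
  using presented_group_class_eq[OF word_eq.relation[OF assms, of "[]" "[]"]]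
  by (simp add: presented_group_word_value)

text \<open>Von Dyck's theorem: once the relations hold in \<open>H\<close>, evaluation of words is
  constant on the classes of \<open>word_eq\<close>, so it descends to the quotient.\<close>

lemma presented_group_lift:
  assumes "group H" and f: "\<And>x. f x \<in> carrier H"
    and R: "\<And>l r. (l, r) \<in> R \<Longrightarrow> word_value H f l = word_value H f r"
  obtains h where "h \<in> hom (presented_group R) H"
    and "\<And>w. h (word_rel R `` {w}) = word_value H f w"
proof
  interpret group H by fact
  \<comment> \<open>An arbitrary representative is evaluated; \<open>word_value_word_eq\<close>
    makes the value independent of the choice.\<close>
  define h where "h X = word_value H f (SOME w. w \<in> X)" for X
  show h: "h (word_rel R `` {w}) = word_value H f w" for w
  proof -
    have "w \<in> word_rel R `` {w}"
      by (simp add: word_rel_def word_eq.refl)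
    then have "(SOME v. v \<in> word_rel R `` {w}) \<in> word_rel R `` {w}"
      by (rule someI)
    then have "word_eq R w (SOME v. v \<in> word_rel R `` {w})"
      by (simp add: word_rel_def)
    then show ?thesis
      unfolding h_def using word_value_word_eq[OF f R] by metis
  qed
  show "h \<in> hom (presented_group R) H"
  proof (rule homI)
    fix X assume "X \<in> carrier (presented_group R)"
    then show "h X \<in> carrier H"
      by (elim presented_group_carrierE) (simp add: h f)
  next
    fix X Y assume "X \<in> carrier (presented_group R)" "Y \<in> carrier (presented_group R)"
    then show "h (X \<otimes>\<^bsub>presented_group R\<^esub> Y) = h X \<otimes>\<^bsub>H\<^esub> h Y"
      by (elim presented_group_carrierE) (simp add: h f presented_group_mult word_value_append)
  qed
qed

text \<open>By induction on words every class is a product of generators and their inverses. This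
  reduces surjectivity of a homomorphism to hitting the generators.\<close>

lemma presented_group_subgroup_eq_carrier:
  assumes "subgroup K (presented_group R)" and gens: "\<And>x. word_rel R `` {[gen x]} \<in> K"
  shows "K = carrier (presented_group R)"
proof
  interpret K: subgroup K "presented_group R" by fact
  interpret group "presented_group R" by (rule group_presented_group)
  show "K \<subseteq> carrier (presented_group R)" by (rule K.subset)
  have "word_rel R `` {w} \<in> K" for w
  proof (induction w)
    case Nil
    then show ?case using K.one_closed by (simp add: presented_group_one)
  next
    case (Cons p w)
    obtain x e where p: "p = (x, e)" by (cases p)
    have "word_rel R `` {[p]} \<in> K"
      using gens[of x] K.m_inv_closed[OF gens[of x]]
      by (cases e) (simp_all add: p presented_group_inv_gen)
    then have "word_rel R `` {[p]} \<otimes>\<^bsub>presented_group R\<^esub> word_rel R `` {w} \<in> K"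
      using Cons by (rule K.m_closed)
    then show ?case by (simp add: presented_group_mult)
  qed
  then show "carrier (presented_group R) \<subseteq> K"
    by (auto elim: presented_group_carrierE)
qed

section \<open>A model of the amphicosm groups\<close>

text \<open>The semidirect product of \<open>\<int>\<^sup>2\<close> by \<open>\<int>\<close>, whose generator acts as
  \<open>(x, y) \<mapsto> (e y - x, y)\<close>, an involution.\<close>

definition amph :: "int \<Rightarrow> (int \<times> int \<times> int) monoid"
  where "amph e =
    \<lparr> carrier = UNIV,
      mult = (\<lambda>(x, y, z) (x', y', z'). (x + (if even z then x' else e * y' - x'), y + y', z + z')),
      one = (0, 0, 0) \<rparr>"

lemma carrier_amph [simp]: "carrier (amph e) = UNIV"
  by (simp add: amph_def)

lemma one_amph [simp]: "\<one>\<^bsub>amph e\<^esub> = (0, 0, 0)"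
  by (simp add: amph_def)

lemma mult_amph [simp]:
  "(x, y, z) \<otimes>\<^bsub>amph e\<^esub> (x', y', z') = (x + (if even z then x' else e * y' - x'), y + y', z + z')"
  by (simp add: amph_def)

lemma group_amph: "group (amph e)"
proof (rule groupI)
  fix g h k :: "int \<times> int \<times> int"
  show "g \<otimes>\<^bsub>amph e\<^esub> h \<otimes>\<^bsub>amph e\<^esub> k = g \<otimes>\<^bsub>amph e\<^esub> (h \<otimes>\<^bsub>amph e\<^esub> k)"
    by (cases g, cases h, cases k) (auto simp: algebra_simps)
  obtain x y z where "g = (x, y, z)" by (cases g)
  then show "\<exists>h\<in>carrier (amph e). h \<otimes>\<^bsub>amph e\<^esub> g = \<one>\<^bsub>amph e\<^esub>"
    by (intro bexI[of _ "(if even z then - x else x - e * y, - y, - z)"]) auto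
qed (auto simp: amph_def)

lemma inv_amph [simp]:
  "inv\<^bsub>amph e\<^esub> (x, y, z) = (if even z then - x else x - e * y, - y, - z)"
  by (rule group.inv_equality[OF group_amph]) auto

lemma int_pow_amph [simp]:
  fixes n :: int
  shows "(1, 0, 0) [^]\<^bsub>amph e\<^esub> n = (n, 0, 0)"
    and "(0, 1, 0) [^]\<^bsub>amph e\<^esub> n = (0, n, 0)"
    and "(0, 0, 1) [^]\<^bsub>amph e\<^esub> n = (0, 0, n)"
proof -
  \<comment> \<open>A homomorphism from \<int> sends \<open>n\<close> to the \<open>n\<close>-th
    power of the image of 1, so it suffices that each coordinate axis is embedded
    homomorphically.\<close>
  have pow: "h 1 [^]\<^bsub>amph e\<^esub> n = h n" if "h \<in> hom integer_group (amph e)" for h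
    using hom_int_pow[OF that _ group_integer_group group_amph, of 1 n] by simp
  show "(1, 0, 0) [^]\<^bsub>amph e\<^esub> n = (n, 0, 0)"
    by (rule pow[of "\<lambda>n. (n, 0, 0)"]) (simp add: hom_def)
  show "(0, 1, 0) [^]\<^bsub>amph e\<^esub> n = (0, n, 0)"
    by (rule pow[of "\<lambda>n. (0, n, 0)"]) (simp add: hom_def)
  show "(0, 0, 1) [^]\<^bsub>amph e\<^esub> n = (0, 0, n)"
    by (rule pow[of "\<lambda>n. (0, 0, n)"]) (simp add: hom_def)
qed

text \<open>The elements \<open>b^x c^y\<close> form an abelian subgroup on which conjugation by
  \<open>a\<close> is the reflection of \<open>amph e\<close>. Hence \<open>a^z\<close> can be moved
  to the right past them, and two normal forms \<open>b^x c^y a^z\<close> multiply exactly as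
  triples do in \<open>amph e\<close>.\<close>

lemma (in group) amph_hom:
  fixes e :: int
  assumes [simp]: "a \<in> carrier G" "b \<in> carrier G" "c \<in> carrier G"
    and cb: "c \<otimes> b = b \<otimes> c" and ab: "a \<otimes> b \<otimes> inv a = inv b"
    and ac: "a \<otimes> c \<otimes> inv a = b [^] e \<otimes> c"
  shows "(\<lambda>(x, y, z). b [^] x \<otimes> c [^] y \<otimes> a [^] z) \<in> hom (amph e) G"
proof -
  have commute: "b [^] x \<otimes> c [^] y = c [^] y \<otimes> b [^] x" for x y :: int
  proof -
    \<comment> \<open>Conjugation by \<open>u\<close> is an endomorphism, so if it fixes
      \<open>v\<close> it fixes every power of \<open>v\<close>. Applied twice below, this passes
      from \<open>c\<close> and \<open>b\<close> to arbitrary powers of both.\<close>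
    have *: "u \<otimes> v [^] i = v [^] i \<otimes> u"
      if [simp]: "u \<in> carrier G" "v \<in> carrier G" and uv: "u \<otimes> v = v \<otimes> u" for u v and i :: int
    proof -
      have "(u \<otimes> v \<otimes> inv u) [^] i = u \<otimes> v [^] i \<otimes> inv u"
      proof -
        have "(\<lambda>v. u \<otimes> v \<otimes> inv u) \<in> hom G G"
          by (rule homI) (simp_all add: m_assoc inv_solve_left)
        from hom_int_pow[OF this _ is_group is_group] show ?thesis by simp
      qed
      moreover have "u \<otimes> v \<otimes> inv u = v"
        by (simp add: uv m_assoc)
      ultimately show ?thesis
        by (simp add: inv_solve_right)
    qed
    show ?thesis
      by (rule *) (simp_all add: *[symmetric] cb)
  qed
  have conj_pow: "a \<otimes> v [^] i \<otimes> inv a = (a \<otimes> v \<otimes> inv a) [^] i"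
    if "v \<in> carrier G" for v and i :: int
  proof -
    have "(\<lambda>v. a \<otimes> v \<otimes> inv a) \<in> hom G G"
      by (rule homI) (simp_all add: m_assoc inv_solve_left)
    from hom_int_pow[OF this that is_group is_group] show ?thesis by simp
  qed
  define N where "N x y = b [^] x \<otimes> c [^] y" for x y :: int
  have N_closed [simp]: "N x y \<in> carrier G" for x y
    by (simp add: N_def)
  have N_mult: "N x y \<otimes> N x' y' = N (x + x') (y + y')" for x y x' y'
  proof -
    have "N x y \<otimes> N x' y' = b [^] x \<otimes> (c [^] y \<otimes> b [^] x') \<otimes> c [^] y'"
      by (simp add: N_def m_assoc)
    also have "\<dots> = (b [^] x \<otimes> b [^] x') \<otimes> (c [^] y \<otimes> c [^] y')"
      by (simp only: commute[symmetric]) (simp add: m_assoc)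
    finally show ?thesis by (simp add: N_def int_pow_mult)
  qed
  have aN: "a \<otimes> N x y = N (e * y - x) y \<otimes> a" for x y
  proof -
    have "a \<otimes> N x y \<otimes> inv a = (a \<otimes> b [^] x \<otimes> inv a) \<otimes> (a \<otimes> c [^] y \<otimes> inv a)"
      by (simp add: N_def m_assoc inv_solve_left)
    also have "a \<otimes> b [^] x \<otimes> inv a = N (- x) 0"
      by (simp add: conj_pow ab N_def int_pow_inv int_pow_neg)
    \<comment> \<open>Conjugation turns \<open>c^y\<close> into \<open>(b^e c)^y\<close>, which
      equals \<open>b^(e y) c^y\<close> because \<open>b\<close> and \<open>c\<close>
      commute.\<close>
    also have "a \<otimes> c [^] y \<otimes> inv a = N (e * y) y"
      using commute[of e 1] commute[of "e * y" y]
      by (simp add: conj_pow ac N_def int_pow_mult_distrib int_pow_pow)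
    finally show ?thesis
      by (simp add: N_mult inv_solve_right')
  qed
  have powN: "a [^] z \<otimes> N x y = N (if even z then x else e * y - x) y \<otimes> a [^] z" for z x y :: int
  proof (induction z arbitrary: x rule: int_induct[of _ 0])
    case base
    then show ?case by simp
  next
    case (step1 i)
    have "a [^] (i + 1) \<otimes> N x y = (a [^] i \<otimes> N (e * y - x) y) \<otimes> a"
      by (simp add: int_pow_mult m_assoc aN)
    then show ?case
      by (simp add: step1(2) int_pow_mult m_assoc)
  next
    case (step2 i)
    \<comment> \<open>The reflection is an involution: moving one \<open>a\<close> past
      \<open>N (e * y - x) y\<close> gives back \<open>N x y\<close>. This is what makes the
      downward step work.\<close>
    have "a [^] i \<otimes> N (e * y - x) y = a [^] (i - 1) \<otimes> (a \<otimes> N (e * y - x) y)"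
      by (simp add: int_pow_diff m_assoc[symmetric]) (simp add: m_assoc)
    also have "\<dots> = a [^] (i - 1) \<otimes> N x y \<otimes> a"
      by (simp add: aN m_assoc)
    finally have "a [^] (i - 1) \<otimes> N x y = a [^] i \<otimes> N (e * y - x) y \<otimes> inv a"
      by (simp add: inv_solve_right)
    then show ?case
      by (simp add: step2(2) int_pow_diff m_assoc)
  qed
  show ?thesis
  proof (rule homI)
    fix g h :: "int \<times> int \<times> int"
    obtain x y z x' y' z' where gh: "g = (x, y, z)" "h = (x', y', z')"
      by (cases g, cases h)
    have "N x y \<otimes> a [^] z \<otimes> (N x' y' \<otimes> a [^] z') =
        N x y \<otimes> (a [^] z \<otimes> N x' y') \<otimes> a [^] z'"
      by (simp add: m_assoc)
    also have "\<dots> = N (x + (if even z then x' else e * y' - x')) (y + y') \<otimes> a [^] (z + z')"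
      by (simp add: powN N_mult[symmetric] int_pow_mult m_assoc)
    finally show "(\<lambda>(x, y, z). b [^] x \<otimes> c [^] y \<otimes> a [^] z) (g \<otimes>\<^bsub>amph e\<^esub> h) =
        (\<lambda>(x, y, z). b [^] x \<otimes> c [^] y \<otimes> a [^] z) g \<otimes> (\<lambda>(x, y, z). b [^] x \<otimes> c [^] y \<otimes> a [^] z) h"
      by (simp add: gh N_def)
  qed auto
qed

text \<open>There are homomorphisms both ways: \<phi> because the classes of \<open>a\<close>,
  \<open>b\<close>, \<open>c\<close> satisfy the relations of the model, and \<psi> by von Dyck
  because the model satisfies \<open>R\<close>. The identity \<psi>(\<phi>(g)) = g gives injectivity
  of \<phi>, and its image contains the generators, which gives surjectivity.\<close>

lemma presented_group_iso_amph:
  fixes R :: "('g word \<times> 'g word) set" and a b c :: 'g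
  defines "G \<equiv> presented_group R" and "cl x \<equiv> word_rel R `` {[gen x]}"
  assumes gens: "UNIV = {a, b, c}" "a \<noteq> b" "a \<noteq> c" "b \<noteq> c"
    and cb: "cl c \<otimes>\<^bsub>G\<^esub> cl b = cl b \<otimes>\<^bsub>G\<^esub> cl c"
    and ab: "cl a \<otimes>\<^bsub>G\<^esub> cl b \<otimes>\<^bsub>G\<^esub> inv\<^bsub>G\<^esub> cl a = inv\<^bsub>G\<^esub> cl b"
    and ac: "cl a \<otimes>\<^bsub>G\<^esub> cl c \<otimes>\<^bsub>G\<^esub> inv\<^bsub>G\<^esub> cl a = cl b [^]\<^bsub>G\<^esub> e \<otimes>\<^bsub>G\<^esub> cl c"
    and R: "\<And>f l r. \<lbrakk>(l, r) \<in> R; f a = (0, 0, 1); f b = (1, 0, 0); f c = (0, 1, 0)\<rbrakk>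
      \<Longrightarrow> word_value (amph e) f l = word_value (amph e) f r"
  shows "amph e \<cong> G"
proof -
  interpret group G unfolding G_def by (rule group_presented_group)
  define \<phi> where "\<phi> = (\<lambda>(x :: int, y :: int, z :: int).
    cl b [^]\<^bsub>G\<^esub> x \<otimes>\<^bsub>G\<^esub> cl c [^]\<^bsub>G\<^esub> y \<otimes>\<^bsub>G\<^esub> cl a [^]\<^bsub>G\<^esub> z)"
  have cl_carrier [simp]: "cl x \<in> carrier G" for x
    by (simp add: cl_def G_def)
  have \<phi>: "\<phi> \<in> hom (amph e) G"
    unfolding \<phi>_def by (rule amph_hom) (simp_all add: cb ab ac)
  define f :: "'g \<Rightarrow> int \<times> int \<times> int"
    where "f x = (if x = a then (0, 0, 1) else if x = b then (1, 0, 0) else (0, 1, 0))" for x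
  have f: "f a = (0, 0, 1)" "f b = (1, 0, 0)" "f c = (0, 1, 0)"
    using gens by (auto simp: f_def)
  obtain \<psi> where \<psi>: "\<psi> \<in> hom G (amph e)" and \<psi>_cl: "\<And>x. \<psi> (cl x) = f x"
  proof (rule presented_group_lift[OF group_amph[of e], of f R])
    fix h assume h: "h \<in> hom (presented_group R) (amph e)"
      "\<And>w. h (word_rel R `` {w}) = word_value (amph e) f w"
    have "h (cl x) = f x" for x
      by (cases "f x") (simp add: h(2) cl_def)
    then show thesis
      using h(1) that by (simp add: G_def)
  qed (use R[OF _ f] in auto)
  have \<psi>_\<phi>: "\<psi> (\<phi> g) = g" for g
  proof -
    obtain x y z where g: "g = (x, y, z)" by (cases g)
    have pow: "\<psi> (cl u [^]\<^bsub>G\<^esub> n) = f u [^]\<^bsub>amph e\<^esub> n" for u and n :: int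
      using hom_int_pow[OF \<psi> _ is_group group_amph] by (simp add: \<psi>_cl)
    show ?thesis
      by (simp add: g \<phi>_def hom_mult[OF \<psi>] pow f)
  qed
  have "\<phi> ` UNIV = carrier G"
    unfolding G_def
  proof (rule presented_group_subgroup_eq_carrier)
    have "group_hom (amph e) G \<phi>"
      by (simp add: group_hom_def group_hom_axioms_def group_amph is_group \<phi>)
    from group_hom.img_is_subgroup[OF this] show "subgroup (\<phi> ` UNIV) (presented_group R)"
      by (simp add: G_def)
    fix x
    have "\<phi> (f x) = cl x"
    proof -
      have "x \<in> {a, b, c}" using gens(1) by auto
      then show ?thesis by (elim insertE) (simp_all add: \<phi>_def f int_pow_1)
    qed
    then show "word_rel R `` {[gen x]} \<in> \<phi> ` UNIV"
      unfolding cl_def by (metis rangeI)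
  qed
  moreover have "inj \<phi>"
    by (metis injI \<psi>_\<phi>)
  ultimately have "\<phi> \<in> iso (amph e) G"
    using \<phi> by (simp add: iso_def bij_betw_def)
  then show ?thesis by (rule is_isoI)
qed

text \<open>Here \<open>c\<close> commutes with \<open>a\<close> and \<open>b\<close>, and
  conjugation by \<open>a\<close> inverts \<open>b\<close>. So \<open>a\<close> acts diagonally on
  the lattice spanned by \<open>b\<close> and \<open>c\<close>, which is the case
  \<open>e = 0\<close>.\<close>

lemma amph_0_iso_pi1_B1: "amph 0 \<cong> pi1_B1"
proof -
  define R :: "(amphi1_gen word \<times> amphi1_gen word) set"
    where "R = {([gen Gen_c, gen Gen_a, gen_inv Gen_c, gen_inv Gen_a], []),
     ([gen Gen_c, gen Gen_b, gen_inv Gen_c, gen_inv Gen_b], []),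
     ([gen Gen_a, gen Gen_b, gen_inv Gen_a, gen Gen_b], [])}"
  interpret group "presented_group R" by (rule group_presented_group)
  define cl where "cl x = word_rel R `` {[gen x]}" for x
  have [simp]: "cl x \<in> carrier (presented_group R)" for x
    by (simp add: cl_def)
  have rel: "word_value (presented_group R) cl l = word_value (presented_group R) cl r"
    if "(l, r) \<in> R" for l r
    using presented_group_relation[OF that] by (simp add: cl_def[abs_def])
  have cb: "cl Gen_c \<otimes>\<^bsub>presented_group R\<^esub> cl Gen_b = cl Gen_b \<otimes>\<^bsub>presented_group R\<^esub> cl Gen_c"
  proof -
    have "word_value (presented_group R) cl [gen Gen_c, gen Gen_b, gen_inv Gen_c, gen_inv Gen_b] = word_value (presented_group R) cl []"
      by (rule rel) (simp add: R_def)
    then show ?thesis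
      by (simp add: m_assoc[symmetric] inv_solve_right')
  qed
  have ca: "cl Gen_c \<otimes>\<^bsub>presented_group R\<^esub> cl Gen_a = cl Gen_a \<otimes>\<^bsub>presented_group R\<^esub> cl Gen_c"
  proof -
    have "word_value (presented_group R) cl [gen Gen_c, gen Gen_a, gen_inv Gen_c, gen_inv Gen_a] = word_value (presented_group R) cl []"
      by (rule rel) (simp add: R_def)
    then show ?thesis
      by (simp add: m_assoc[symmetric] inv_solve_right')
  qed
  have ab: "cl Gen_a \<otimes>\<^bsub>presented_group R\<^esub> cl Gen_b \<otimes>\<^bsub>presented_group R\<^esub> inv\<^bsub>presented_group R\<^esub> cl Gen_a =
      inv\<^bsub>presented_group R\<^esub> cl Gen_b"
  proof -
    have "word_value (presented_group R) cl [gen Gen_a, gen Gen_b, gen_inv Gen_a, gen Gen_b] = word_value (presented_group R) cl []"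
      by (rule rel) (simp add: R_def)
    then show ?thesis
      by (simp add: m_assoc[symmetric] inv_equality[symmetric])
  qed
  note eqs = cb ab ca[symmetric] m_assoc
  have "amph 0 \<cong> presented_group R"
  proof (rule presented_group_iso_amph[of Gen_a Gen_b Gen_c])
    show "UNIV = {Gen_a, Gen_b, Gen_c}"
      using amphi1_gen.exhaust by auto
    fix f :: "amphi1_gen \<Rightarrow> int \<times> int \<times> int" and l r
    assume "(l, r) \<in> R" "f Gen_a = (0, 0, 1)" "f Gen_b = (1, 0, 0)" "f Gen_c = (0, 1, 0)"
    then show "word_value (amph 0) f l = word_value (amph 0) f r"
      by (auto simp: R_def)
  qed (simp_all add: cl_def[symmetric] eqs)
  then show ?thesis by (simp add: pi1_B1_def R_def)
qed

text \<open>The second relation reads \<alpha> \<gamma> \<alpha>^(-1) = \<beta> \<gamma>, which is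
  the case \<open>e = 1\<close>. Conjugation by \<alpha> then swaps the basis vectors \<gamma> and
  \<beta> \<gamma> of the lattice.\<close>

lemma amph_1_iso_pi1_B2: "amph 1 \<cong> pi1_B2"
proof -
  define R :: "(amphi2_gen word \<times> amphi2_gen word) set"
    where "R = {([gen Gen_gamma, gen Gen_beta, gen_inv Gen_gamma], [gen Gen_beta]),
     ([gen Gen_alpha, gen Gen_gamma, gen_inv Gen_alpha, gen_inv Gen_gamma], [gen Gen_beta]),
     ([gen Gen_alpha, gen Gen_beta, gen_inv Gen_alpha], [gen_inv Gen_beta])}"
  interpret group "presented_group R" by (rule group_presented_group)
  define cl where "cl x = word_rel R `` {[gen x]}" for x
  have [simp]: "cl x \<in> carrier (presented_group R)" for x
    by (simp add: cl_def)
  have rel: "word_value (presented_group R) cl l = word_value (presented_group R) cl r"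
    if "(l, r) \<in> R" for l r
    using presented_group_relation[OF that] by (simp add: cl_def[abs_def])
  have cb: "cl Gen_gamma \<otimes>\<^bsub>presented_group R\<^esub> cl Gen_beta =
      cl Gen_beta \<otimes>\<^bsub>presented_group R\<^esub> cl Gen_gamma"
  proof -
    have "word_value (presented_group R) cl [gen Gen_gamma, gen Gen_beta, gen_inv Gen_gamma] = word_value (presented_group R) cl [gen Gen_beta]"
      by (rule rel) (simp add: R_def)
    then show ?thesis
      by (simp add: m_assoc[symmetric] inv_solve_right')
  qed
  have ac: "cl Gen_alpha \<otimes>\<^bsub>presented_group R\<^esub> cl Gen_gamma \<otimes>\<^bsub>presented_group R\<^esub>
      inv\<^bsub>presented_group R\<^esub> cl Gen_alpha =
      cl Gen_beta \<otimes>\<^bsub>presented_group R\<^esub> cl Gen_gamma"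
  proof -
    have "word_value (presented_group R) cl [gen Gen_alpha, gen Gen_gamma, gen_inv Gen_alpha, gen_inv Gen_gamma] = word_value (presented_group R) cl [gen Gen_beta]"
      by (rule rel) (simp add: R_def)
    then show ?thesis
      by (simp add: m_assoc[symmetric] inv_solve_right')
  qed
  have ab: "cl Gen_alpha \<otimes>\<^bsub>presented_group R\<^esub> cl Gen_beta \<otimes>\<^bsub>presented_group R\<^esub>
      inv\<^bsub>presented_group R\<^esub> cl Gen_alpha = inv\<^bsub>presented_group R\<^esub> cl Gen_beta"
  proof -
    have "word_value (presented_group R) cl [gen Gen_alpha, gen Gen_beta, gen_inv Gen_alpha] = word_value (presented_group R) cl [gen_inv Gen_beta]"
      by (rule rel) (simp add: R_def)
    then show ?thesis
      by (simp add: m_assoc[symmetric])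
  qed
  note eqs = cb ab ac int_pow_1
  have "amph 1 \<cong> presented_group R"
  proof (rule presented_group_iso_amph[of Gen_alpha Gen_beta Gen_gamma])
    show "UNIV = {Gen_alpha, Gen_beta, Gen_gamma}"
      using amphi2_gen.exhaust by auto
    fix f :: "amphi2_gen \<Rightarrow> int \<times> int \<times> int" and l r
    assume "(l, r) \<in> R" "f Gen_alpha = (0, 0, 1)" "f Gen_beta = (1, 0, 0)" "f Gen_gamma = (0, 1, 0)"
    then show "word_value (amph 1) f l = word_value (amph 1) f r"
      by (auto simp: R_def)
  qed (simp_all add: cl_def[symmetric] eqs)
  then show ?thesis by (simp add: pi1_B2_def R_def)
qed

section \<open>Isomorphism types\<close>

lemma group_Z3: "group Z3"
  by (simp add: Z3_def DirProd_group)

lemma carrier_Z3 [simp]: "carrier Z3 = UNIV"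
  by (simp add: Z3_def)

lemma mult_Z3 [simp]: "(x, y, z) \<otimes>\<^bsub>Z3\<^esub> (x', y', z') = (x + x', y + y', z + z')"
  by (simp add: Z3_def)

text \<open>The shear \<open>(x, y) \<mapsto> (x + k * y, y)\<close> conjugates the reflection with
  parameter \<open>e\<close> into the one with parameter \<open>e + 2 * k\<close>. So only the
  parity of \<open>e\<close> matters.\<close>

lemma amph_iso_shift: "amph e \<cong> amph (e + 2 * k)"
proof -
  have "(\<lambda>(x, y, z). (x + k * y, y, z)) \<in> iso (amph e) (amph (e + 2 * k))"
  proof (rule isoI)
    show "(\<lambda>(x, y, z). (x + k * y, y, z)) \<in> hom (amph e) (amph (e + 2 * k))"
      by (rule homI) (auto simp: algebra_simps)
    show "bij_betw (\<lambda>(x, y, z). (x + k * y, y, z)) (carrier (amph e)) (carrier (amph (e + 2 * k)))"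
      by (rule bij_betw_byWitness[where f' = "\<lambda>(x, y, z). (x - k * y, y, z)"]) auto
  qed
  then show ?thesis by (rule is_isoI)
qed

lemma iso_amph_mod_2: "amph e \<cong> amph (e mod 2)"
proof -
  have "e mod 2 = e + 2 * (- (e div 2))"
    using div_mult_mod_eq[of e 2] by linarith
  then show ?thesis
    using amph_iso_shift[of e "- (e div 2)"] by simp
qed

text \<open>Every commutator is a square, written without inverses.\<close>

definition commutators_square :: "('a, 'c) monoid_scheme \<Rightarrow> bool"
  where "commutators_square G \<longleftrightarrow>
    (\<forall>g\<in>carrier G. \<forall>h\<in>carrier G. \<exists>k\<in>carrier G. g \<otimes>\<^bsub>G\<^esub> h = k \<otimes>\<^bsub>G\<^esub> k \<otimes>\<^bsub>G\<^esub> (h \<otimes>\<^bsub>G\<^esub> g))"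

lemma commutators_square_iso:
  assumes "G \<cong> H" "commutators_square G" "group G" "group H"
  shows "commutators_square H"
  unfolding commutators_square_def
proof (intro ballI)
  obtain f where f: "f \<in> hom G H" "f ` carrier G = carrier H"
    using assms(1) by (auto simp: is_iso_def iso_def bij_betw_def)
  fix g' h' assume "g' \<in> carrier H" "h' \<in> carrier H"
  then obtain g h where gh: "g \<in> carrier G" "g' = f g" "h \<in> carrier G" "h' = f h"
    using f(2) by blast
  then obtain k where k: "k \<in> carrier G" "g \<otimes>\<^bsub>G\<^esub> h = k \<otimes>\<^bsub>G\<^esub> k \<otimes>\<^bsub>G\<^esub> (h \<otimes>\<^bsub>G\<^esub> g)"
    using assms(2) unfolding commutators_square_def by blast
  have "f (g \<otimes>\<^bsub>G\<^esub> h) = f (k \<otimes>\<^bsub>G\<^esub> k \<otimes>\<^bsub>G\<^esub> (h \<otimes>\<^bsub>G\<^esub> g))"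
    using k by simp
  then have "g' \<otimes>\<^bsub>H\<^esub> h' = f k \<otimes>\<^bsub>H\<^esub> f k \<otimes>\<^bsub>H\<^esub> (h' \<otimes>\<^bsub>H\<^esub> g')"
    using gh k(1) assms(3) by (simp add: hom_mult[OF f(1)] group.is_monoid monoid.m_closed)
  moreover have "f k \<in> carrier H"
    using k(1) f by blast
  ultimately show "\<exists>k\<in>carrier H. g' \<otimes>\<^bsub>H\<^esub> h' = k \<otimes>\<^bsub>H\<^esub> k \<otimes>\<^bsub>H\<^esub> (h' \<otimes>\<^bsub>H\<^esub> g')"
    by blast
qed

text \<open>For \<open>e = 0\<close> the action on the first coordinate is a sign and the second
  coordinate is fixed, so every commutator has the form \<open>(2 * k, 0, 0)\<close> and is the
  square of \<open>(k, 0, 0)\<close>.\<close>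

lemma commutators_square_amph_0: "commutators_square (amph 0)"
  unfolding commutators_square_def
proof (intro ballI)
  fix g h :: "int \<times> int \<times> int"
  obtain x y z x' y' z' where gh: "g = (x, y, z)" "h = (x', y', z')"
    by (cases g, cases h)
  define k where "k = (if even z then if even z' then 0 else x else if even z' then - x' else x - x')"
  show "\<exists>k\<in>carrier (amph 0). g \<otimes>\<^bsub>amph 0\<^esub> h =
      k \<otimes>\<^bsub>amph 0\<^esub> k \<otimes>\<^bsub>amph 0\<^esub> (h \<otimes>\<^bsub>amph 0\<^esub> g)"
    by (rule bexI[of _ "(k, 0, 0)"]) (auto simp: gh k_def)
qed

text \<open>The commutator of \<open>(0, 0, 1)\<close> and \<open>(0, 1, 0)\<close> is
  \<open>(1, 0, 0)\<close>. A square root would have vanishing last two coordinates, and then its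
  first coordinate would be one half.\<close>

lemma not_commutators_square_amph_1: "\<not> commutators_square (amph 1)"
proof
  assume "commutators_square (amph 1)"
  then obtain k where "(0, 0, 1) \<otimes>\<^bsub>amph 1\<^esub> (0, 1, 0) =
      k \<otimes>\<^bsub>amph 1\<^esub> k \<otimes>\<^bsub>amph 1\<^esub> ((0, 1, 0) \<otimes>\<^bsub>amph 1\<^esub> (0, 0, 1))"
    unfolding commutators_square_def carrier_amph by blast
  moreover obtain x y z where "k = (x, y, z)" by (cases k)
  ultimately have "x + x = 1"
    by (simp split: if_splits)
  then show False by presburger
qed

lemma not_amph_0_iso_amph_1: "\<not> amph 0 \<cong> amph 1"
  using commutators_square_iso[OF _ commutators_square_amph_0 group_amph group_amph]
    not_commutators_square_amph_1 by blast

text \<open>\<open>Z3\<close> is abelian, whereas conjugation by \<open>(0, 0, 1)\<close> inverts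
  \<open>(1, 0, 0)\<close>.\<close>

lemma not_Z3_iso_amph: "\<not> Z3 \<cong> amph e"
proof
  assume "Z3 \<cong> amph e"
  then obtain f where f: "f \<in> hom Z3 (amph e)" "f ` UNIV = UNIV"
    by (auto simp: is_iso_def iso_def bij_betw_def)
  obtain g h where gh: "f g = (1, 0, 0)" "f h = (0, 0, 1)"
    using f(2) by (metis UNIV_I imageE)
  have "g \<otimes>\<^bsub>Z3\<^esub> h = h \<otimes>\<^bsub>Z3\<^esub> g"
    by (cases g, cases h) simp
  then have "f g \<otimes>\<^bsub>amph e\<^esub> f h = f h \<otimes>\<^bsub>amph e\<^esub> f g"
    using hom_mult[OF f(1)] by (metis UNIV_I carrier_Z3)
  then show False by (simp add: gh)
qed

section \<open>Subgroups of finite index\<close>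

lemma card_rcosets_transversal:
  fixes G (structure)
  assumes "group G" "subgroup \<Delta> G" and T: "T \<subseteq> carrier G"
    and ex: "\<And>g. g \<in> carrier G \<Longrightarrow> \<exists>d\<in>\<Delta>. \<exists>t\<in>T. g = d \<otimes>\<^bsub>G\<^esub> t"
    and uniq: "\<And>d t t'. \<lbrakk>d \<in> \<Delta>; t \<in> T; t' \<in> T; t = d \<otimes>\<^bsub>G\<^esub> t'\<rbrakk> \<Longrightarrow> t = t'"
  shows "card (rcosets\<^bsub>G\<^esub> \<Delta>) = card T"
proof -
  interpret group G by fact
  interpret subgroup \<Delta> G by fact
  have "bij_betw (\<lambda>t. \<Delta> #> t) T (rcosets \<Delta>)"
    unfolding bij_betw_def
  proof
    show "inj_on (\<lambda>t. \<Delta> #> t) T"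
    proof (rule inj_onI)
      fix t t' assume t: "t \<in> T" "t' \<in> T" "\<Delta> #> t = \<Delta> #> t'"
      then have "t \<in> \<Delta> #> t'"
        using rcos_self[of t \<Delta>] T assms(2) by auto
      then show "t = t'"
        using uniq t by (auto simp: r_coset_def)
    qed
    show "(\<lambda>t. \<Delta> #> t) ` T = rcosets \<Delta>"
    proof
      show "(\<lambda>t. \<Delta> #> t) ` T \<subseteq> rcosets \<Delta>"
        using T by (auto simp: RCOSETS_def)
      show "rcosets \<Delta> \<subseteq> (\<lambda>t. \<Delta> #> t) ` T"
      proof
        fix X assume "X \<in> rcosets \<Delta>"
        then obtain g where g: "g \<in> carrier G" "X = \<Delta> #> g"
          by (auto simp: RCOSETS_def)
        obtain d t where dt: "d \<in> \<Delta>" "t \<in> T" "g = d \<otimes> t"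
          using ex[OF g(1)] by blast
        then have "g \<in> \<Delta> #> t"
          by (auto simp: r_coset_def)
        then have "X = \<Delta> #> t"
          using repr_independence[of g \<Delta> t] dt T assms(2) g(2) by auto
        then show "X \<in> (\<lambda>t. \<Delta> #> t) ` T"
          using dt(2) by blast
      qed
    qed
  qed
  then show ?thesis
    using bij_betw_same_card by fastforce
qed

text \<open>Pigeonhole: two powers of \<open>g\<close> lie in the same right coset, and their
  quotient is a positive power of \<open>g\<close> in \<Delta>.\<close>

lemma (in group) finite_index_pow:
  assumes "subgroup \<Delta> G" "finite (rcosets \<Delta>)" "g \<in> carrier G"
  obtains k :: nat where "k > 0" "g [^] k \<in> \<Delta>"
proof -
  interpret subgroup \<Delta> G by fact
  have "range (\<lambda>i :: nat. \<Delta> #> g [^] i) \<subseteq> rcosets \<Delta>"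
    using assms(3) by (auto simp: RCOSETS_def)
  then have "\<not> inj (\<lambda>i :: nat. \<Delta> #> g [^] i)"
    using assms(2) by (meson finite_imageD finite_subset infinite_UNIV_nat)
  then obtain i j :: nat where ij: "i < j" "\<Delta> #> g [^] i = \<Delta> #> g [^] j"
    by (metis (mono_tags, lifting) injI linorder_neqE_nat)
  have "g [^] j \<in> \<Delta> #> g [^] i"
    using rcos_self[of "g [^] j" \<Delta>] assms ij(2) by auto
  then obtain d where d: "d \<in> \<Delta>" "g [^] j = d \<otimes> g [^] i"
    by (auto simp: r_coset_def)
  have "g [^] (j - i) \<otimes> g [^] i = d \<otimes> g [^] i"
    using ij(1) assms(3) d(2) by (simp add: nat_pow_mult)
  then have "g [^] (j - i) = d"
    using assms(3) d(1) by (simp add: subgroup.mem_carrier[OF assms(1)])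
  then show thesis
    using that[of "j - i"] ij(1) d(1) by simp
qed

text \<open>The generator is the least positive element; the remainder of any other element modulo
  it again satisfies \<open>P\<close> and must be zero. A predicate in place of a set lets the lemma
  apply directly to coordinate slices and projections of \<Delta>.\<close>

lemma int_subgroup_multiples:
  fixes P :: "int \<Rightarrow> bool"
  assumes diff: "\<And>x y. \<lbrakk>P x; P y\<rbrakk> \<Longrightarrow> P (x - y)" and "P x" "x \<noteq> 0"
  obtains d :: nat where "d > 0" "\<And>x. P x \<longleftrightarrow> int d dvd x"
proof -
  have zero: "P 0"
    using diff[OF assms(2) assms(2)] by simp
  have neg: "P (- x)" if "P x" for x
    using diff[OF zero that] by simp
  have add: "P (x + y)" if "P x" "P y" for x y
    using diff[OF that(1) neg[OF that(2)]] by simp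
  have mult: "P (k * x)" if "P x" for k x
    by (induction k rule: int_induct[of _ 0])
      (use zero that add diff in \<open>auto simp: algebra_simps\<close>)
  define Q where "Q d \<longleftrightarrow> d > 0 \<and> P (int d)" for d :: nat
  have "Q (nat \<bar>x\<bar>)"
    using assms(2,3) neg by (auto simp: Q_def abs_if)
  define d where "d = (LEAST d. Q d)"
  have "Q d"
    unfolding d_def by (rule LeastI) fact
  then have d: "d > 0" "P (int d)"
    by (simp_all add: Q_def)
  have "int d dvd y" if "P y" for y
  proof -
    have "P (y - y div int d * int d)"
      by (rule diff[OF that mult[OF d(2)]])
    then have "P (int (nat (y mod int d)))"
      using d(1) by (simp add: minus_div_mult_eq_mod)
    moreover have "nat (y mod int d) < d"
      using d(1) by (simp add: nat_less_iff)
    then have "\<not> Q (nat (y mod int d))"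
      unfolding d_def by (rule not_less_Least)
    ultimately have "nat (y mod int d) = 0"
      by (simp add: Q_def)
    moreover have "y mod int d \<ge> 0"
      using d(1) by simp
    ultimately have "y mod int d = 0"
      by linarith
    then show ?thesis by (rule mod_0_imp_dvd)
  qed
  moreover have "P y" if "int d dvd y" for y
  proof -
    obtain k where "y = k * int d"
      using \<open>int d dvd y\<close> by (metis dvdE mult.commute)
    then show ?thesis
      using mult[OF d(2), of k] by simp
  qed
  ultimately show thesis
    using that[OF d(1)] by blast
qed

text \<open>The subgroup of \<open>amph 1\<close> generated by \<open>(p, 0, 0)\<close>, \<open>(q, r, 0)\<close> and \<open>u = (a, b, l)\<close> is
  the range of \<open>sub_emb l p r q a b\<close>. For odd \<open>l\<close>, the second summand of the first coordinate
  comes from \<open>u\<^sup>2 = (b, 2 b, 2 l)\<close>.\<close>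

definition sub_emb :: "int \<Rightarrow> int \<Rightarrow> int \<Rightarrow> int \<Rightarrow> int \<Rightarrow> int \<Rightarrow> int \<times> int \<times> int \<Rightarrow> int \<times> int \<times> int"
  where "sub_emb l p r q a b = (\<lambda>(x, y, w).
    (p * x + q * y + (if even l then a * w else b * (w div 2) + a * (w mod 2)), r * y + b * w, l * w))"

lemma sub_emb_simps:
  "sub_emb l p r q a b (x, y, 0) = (p * x + q * y, r * y, 0)"
  "sub_emb l p r q a b (0, 0, 1) = (a, b, l)"
  by (simp_all add: sub_emb_def)

text \<open>For even \<open>l\<close> the image consists of triples with even last coordinate. These
  act trivially on the lattice, so they multiply by plain addition.\<close>

lemma sub_emb_hom_Z3:
  assumes "even l"
  shows "sub_emb l p r q a b \<in> hom Z3 (amph 1)"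
  by (rule homI) (use assms in \<open>auto simp: sub_emb_def algebra_simps\<close>)

text \<open>For odd \<open>l\<close> the lift of the generator acts by the reflection, which sends
  \<open>(p, 0)\<close> to its negative and \<open>(q, r)\<close> to \<open>(r - q, r)\<close>, that
  is, to \<open>(q, r)\<close> plus \<open>t\<close> times \<open>(p, 0)\<close>. In the basis
  \<open>(p, 0)\<close>, \<open>(q, r)\<close> this is the reflection of
  \<open>amph t\<close>.\<close>

lemma sub_emb_hom_amph:
  assumes "odd l" and t: "r - 2 * q = p * t"
  shows "sub_emb l p r q a b \<in> hom (amph t) (amph 1)"
proof (rule homI)
  fix g h :: "int \<times> int \<times> int"
  obtain x y w x' y' w' where gh: "g = (x, y, w)" "h = (x', y', w')"
    by (cases g, cases h)
  have r: "r = p * t + 2 * q"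
    using t by simp
  obtain m where m: "l = 2 * m + 1"
    using assms(1) by (rule oddE)
  have odd: "(1 + (u' * 2 + u * 2)) mod 2 = 1" for u u' :: int
    by presburger
  \<comment> \<open>Fixing the parities of \<open>w\<close> and \<open>w'\<close> evaluates the
    \<open>div\<close> and \<open>mod\<close> in \<open>sub_emb\<close> and the parity tests in both
    products.\<close>
  obtain u where u: "w = 2 * u \<or> w = 2 * u + 1"
    by (metis evenE oddE)
  obtain u' where u': "w' = 2 * u' \<or> w' = 2 * u' + 1"
    by (metis evenE oddE)
  show "sub_emb l p r q a b (g \<otimes>\<^bsub>amph t\<^esub> h) =
      sub_emb l p r q a b g \<otimes>\<^bsub>amph 1\<^esub> sub_emb l p r q a b h"
    unfolding gh using m u u'
    by (elim disjE) (simp_all add: sub_emb_def r algebra_simps odd cong: if_cong)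
qed simp

text \<open>The hypothesis expresses invariance of the lattice under the action of the lift. It
  provides one of the two source groups, from which facts about the range can be read off
  uniformly.\<close>

lemma sub_emb_hom_cases:
  assumes "odd l \<longrightarrow> p dvd r - 2 * q"
  obtains "even l" "sub_emb l p r q a b \<in> hom Z3 (amph 1)"
  | t where "odd l" "r - 2 * q = p * t" "sub_emb l p r q a b \<in> hom (amph t) (amph 1)"
  using assms sub_emb_hom_Z3 sub_emb_hom_amph by (metis dvdE)

lemma inj_sub_emb:
  assumes "l \<noteq> 0" "p \<noteq> 0" "r \<noteq> 0"
  shows "inj (sub_emb l p r q a b)"
  by (rule injI) (use assms in \<open>auto simp: sub_emb_def\<close>)

lemma subgroup_sub_emb:
  assumes "odd l \<longrightarrow> p dvd r - 2 * q"
  shows "subgroup (range (sub_emb l p r q a b)) (amph 1)"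
  using assms
proof (cases rule: sub_emb_hom_cases[of l p r q a b])
  case 1
  then have "group_hom Z3 (amph 1) (sub_emb l p r q a b)"
    by (simp add: group_hom_def group_hom_axioms_def group_amph group_Z3)
  from group_hom.img_is_subgroup[OF this] show ?thesis by simp
next
  case (2 t)
  then have "group_hom (amph t) (amph 1) (sub_emb l p r q a b)"
    by (simp add: group_hom_def group_hom_axioms_def group_amph)
  from group_hom.img_is_subgroup[OF this] show ?thesis by simp
qed

text \<open>Consequently \<open>sub_emb l p r q a b (0, 0, w)\<close> runs through the powers of the
  lift \<open>(a, b, l)\<close>.\<close>

lemma sub_emb_add:
  assumes "odd l \<longrightarrow> p dvd r - 2 * q"
  shows "sub_emb l p r q a b (0, 0, w + w') =
    sub_emb l p r q a b (0, 0, w) \<otimes>\<^bsub>amph 1\<^esub> sub_emb l p r q a b (0, 0, w')"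
  using assms
proof (cases rule: sub_emb_hom_cases[of l p r q a b])
  case 1
  from hom_mult[OF 1(2), of "(0, 0, w)" "(0, 0, w')"] show ?thesis by simp
next
  case (2 t)
  from hom_mult[OF 2(3), of "(0, 0, w)" "(0, 0, w')"] show ?thesis by (simp cong: if_cong)
qed

lemma iso_image_of_hom:
  assumes "h \<in> hom G H" "inj_on h (carrier G)"
  shows "G \<cong> H\<lparr>carrier := h ` carrier G\<rparr>"
proof (rule is_isoI, rule isoI)
  show "h \<in> hom G (H\<lparr>carrier := h ` carrier G\<rparr>)"
    using assms(1) by (auto simp: hom_def)
qed (use assms(2) in \<open>simp add: bij_betw_def\<close>)

lemma Z3_iso_sub_emb:
  assumes "even l" "l \<noteq> 0" "p \<noteq> 0" "r \<noteq> 0"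
  shows "Z3 \<cong> (amph 1)\<lparr>carrier := range (sub_emb l p r q a b)\<rparr>"
  using iso_image_of_hom[OF sub_emb_hom_Z3[OF assms(1)]] inj_sub_emb[OF assms(2-4)]
  by simp

lemma amph_iso_sub_emb:
  assumes "odd l" "p dvd r - 2 * q" "l \<noteq> 0" "p \<noteq> 0" "r \<noteq> 0"
  shows "amph (((r - 2 * q) div p) mod 2) \<cong> (amph 1)\<lparr>carrier := range (sub_emb l p r q a b)\<rparr>"
proof -
  let ?t = "(r - 2 * q) div p"
  have "amph (?t mod 2) \<cong> amph ?t"
    by (rule group.iso_sym[OF group_amph iso_amph_mod_2])
  moreover have "amph ?t \<cong> (amph 1)\<lparr>carrier := range (sub_emb l p r q a b)\<rparr>"
    using iso_image_of_hom[OF sub_emb_hom_amph[OF assms(1)], of r q p ?t a b]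
      inj_sub_emb[OF assms(3-5), of q a b] assms(2)
    by simp
  ultimately show ?thesis by (rule iso_trans)
qed

section \<open>The index of the parametrised subgroups\<close>

lemma int_residue_unique:
  fixes k k' l w :: int
  assumes "k = l * w + k'" "0 \<le> k" "k < l" "0 \<le> k'" "k' < l"
  shows "w = 0" "k = k'"
proof -
  show "k = k'"
    using assms by (metis mod_mult_self4 mod_pos_pos_trivial)
  then show "w = 0"
    using assms by auto
qed

text \<open>The generators are in triangular form, so division with remainder works coordinate by
  coordinate: the third by \<open>l\<close>, then the second by \<open>r\<close>, then the first by
  \<open>p\<close>.\<close>

lemma sub_emb_transversal:
  assumes "l > 0" "p > 0" "r > 0"
  obtains x y w i j k where "0 \<le> i" "i < p" "0 \<le> j" "j < r" "0 \<le> k" "k < l"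
    and "g = sub_emb l p r q a b (0, 0, w) \<otimes>\<^bsub>amph 1\<^esub> (sub_emb l p r q a b (x, y, 0) \<otimes>\<^bsub>amph 1\<^esub> (i, j, k))"
proof -
  interpret group "amph 1" by (rule group_amph)
  obtain X Y Z where g: "g = (X, Y, Z)" by (cases g)
  define w where "w = Z div l"
  let ?u = "sub_emb l p r q a b (0, 0, w)"
  \<comment> \<open>Removing a power of the lift on the left reduces the third coordinate modulo
    \<open>l\<close> but alters the other two, hence the fresh \<open>X'\<close> and
    \<open>Y'\<close>.\<close>
  obtain X' Y' k where h: "inv\<^bsub>amph 1\<^esub> ?u \<otimes>\<^bsub>amph 1\<^esub> g = (X', Y', k)"
    by (cases "inv\<^bsub>amph 1\<^esub> ?u \<otimes>\<^bsub>amph 1\<^esub> g")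
  then have "k = Z - l * w"
    by (auto simp: g sub_emb_def)
  then have k: "k = Z mod l"
    by (simp add: w_def minus_mult_div_eq_mod)
  define y where "y = Y' div r"
  define x where "x = (X' - q * y) div p"
  have "g = ?u \<otimes>\<^bsub>amph 1\<^esub> (X', Y', k)"
    unfolding h[symmetric] using mult_inv_cancel_left(1)[of ?u g] by simp
  also have "(X', Y', k) = sub_emb l p r q a b (x, y, 0) \<otimes>\<^bsub>amph 1\<^esub> ((X' - q * y) mod p, Y' mod r, k)"
    using mult_div_mod_eq[of p "X' - q * y"] mult_div_mod_eq[of r Y']
    by (simp add: sub_emb_simps x_def[symmetric] y_def[symmetric])
  finally show thesis
    using that[of "(X' - q * y) mod p" "Y' mod r" k w x y] assms k by simp
qed

text \<open>The box of sides \<open>p\<close>, \<open>r\<close>, \<open>l\<close> is a transversal: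
  division reaches it from every element, and two of its points in one coset agree by uniqueness of
  remainders.\<close>

lemma card_rcosets_sub_emb:
  fixes l p r :: nat
  assumes "l > 0" "p > 0" "r > 0" and adm: "odd l \<longrightarrow> int p dvd int r - 2 * q"
  shows "card (rcosets\<^bsub>amph 1\<^esub> (range (sub_emb (int l) (int p) (int r) q a b))) = l * p * r"
proof -
  let ?f = "sub_emb (int l) (int p) (int r) q a b"
  let ?T = "{0..<int p} \<times> {0..<int r} \<times> {0..<int l}"
  have sub: "subgroup (range ?f) (amph 1)"
    using subgroup_sub_emb adm by simp
  have pos: "int l > 0" "int p > 0" "int r > 0"
    using assms(1-3) by simp_all
  have "card (rcosets\<^bsub>amph 1\<^esub> (range ?f)) = card ?T"
  proof (rule card_rcosets_transversal[OF group_amph sub])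
    fix g :: "int \<times> int \<times> int"
    obtain x y w i j k where *: "0 \<le> i" "i < int p" "0 \<le> j" "j < int r" "0 \<le> k" "k < int l"
      "g = ?f (0, 0, w) \<otimes>\<^bsub>amph 1\<^esub> (?f (x, y, 0) \<otimes>\<^bsub>amph 1\<^esub> (i, j, k))"
      by (rule sub_emb_transversal[OF pos]) (rule that; assumption)
    have "g = (?f (0, 0, w) \<otimes>\<^bsub>amph 1\<^esub> ?f (x, y, 0)) \<otimes>\<^bsub>amph 1\<^esub> (i, j, k)"
      using *(7) by (simp add: monoid.m_assoc[OF group.is_monoid[OF group_amph]])
    moreover have "?f (0, 0, w) \<otimes>\<^bsub>amph 1\<^esub> ?f (x, y, 0) \<in> range ?f"
      by (rule subgroup.m_closed[OF sub]) auto
    ultimately show "\<exists>d\<in>range ?f. \<exists>t\<in>?T. g = d \<otimes>\<^bsub>amph 1\<^esub> t"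
      using *(1-6) by (metis atLeastLessThan_iff mem_Sigma_iff)
  next
    fix d t t' assume d: "d \<in> range ?f" "t \<in> ?T" "t' \<in> ?T" "t = d \<otimes>\<^bsub>amph 1\<^esub> t'"
    obtain x y w where xyw: "d = ?f (x, y, w)"
      using d(1) by auto
    obtain i j k i' j' k' where t: "t = (i, j, k)" "t' = (i', j', k')"
      by (cases t, cases t')
    \<comment> \<open>The coordinates are compared from the last to the first: \<open>w = 0\<close>
      turns the second equation into one modulo \<open>r\<close>, and \<open>y = 0\<close> turns the
      first into one modulo \<open>p\<close>.\<close>
    have w: "w = 0" "k = k'"
      using int_residue_unique[of k "int l" w k'] d by (auto simp: t xyw sub_emb_def)
    have y: "y = 0" "j = j'"
      using int_residue_unique[of j "int r" y j'] d by (auto simp: t xyw sub_emb_def w)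
    have "i = i'"
      using int_residue_unique[of i "int p" x i'] d by (auto simp: t xyw sub_emb_def w y)
    then show "t = t'"
      by (simp add: t w y)
  qed simp
  then show ?thesis
    by simp
qed

section \<open>Uniqueness of the normal form\<close>

lemma sub_emb_range_dvd:
  assumes "l' \<noteq> 0" "r' \<noteq> 0"
    and "range (sub_emb l p r q a b) \<subseteq> range (sub_emb l' p' r' q' a' b')"
  shows "l' dvd l" "p' dvd p" "r' dvd r"
proof -
  have mem: "sub_emb l p r q a b g \<in> range (sub_emb l' p' r' q' a' b')" for g
    using assms(3) by blast
  show "l' dvd l"
    using mem[of "(0, 0, 1)"] by (auto simp: sub_emb_def)
  show "p' dvd p"
    using mem[of "(1, 0, 0)"] assms(1,2) by (auto simp: sub_emb_def cong: if_cong)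
  show "r' dvd r"
    using mem[of "(0, 1, 0)"] assms(1) by (auto simp: sub_emb_def)
qed

text \<open>Mutual inclusion makes the diagonal entries divide each other. Writing
  \<open>(q, r, 0)\<close> and \<open>(a, b, l)\<close> in the other generators then shows that the
  reduced residues agree.\<close>

lemma sub_emb_range_eqD:
  fixes l p r q a b l' p' r' q' a' b' :: nat
  assumes pos: "l > 0" "p > 0" "r > 0" "l' > 0" "p' > 0" "r' > 0"
    and less: "q < p" "a < p" "b < r" "q' < p'" "a' < p'" "b' < r'"
    and eq: "range (sub_emb (int l) (int p) (int r) (int q) (int a) (int b)) =
      range (sub_emb (int l') (int p') (int r') (int q') (int a') (int b'))"
  shows "l = l' \<and> p = p' \<and> r = r' \<and> q = q' \<and> a = a' \<and> b = b'"
proof -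
  have lpr: "l = l'" "p = p'" "r = r'"
    using sub_emb_range_dvd[OF _ _ eq[THEN equalityD1]] sub_emb_range_dvd[OF _ _ eq[THEN equalityD2]] pos
    by (auto intro: dvd_antisym)
  have mem: "sub_emb (int l) (int p) (int r) (int q) (int a) (int b) g \<in> range (sub_emb (int l) (int p) (int r) (int q') (int a') (int b'))" for g
    using eq lpr by auto
  obtain x where x: "int q = int p * x + int q'"
    using mem[of "(0, 1, 0)"] pos by (auto simp: sub_emb_def cong: if_cong)
  have "q = q'"
    using int_residue_unique(2)[OF x] less lpr by simp
  \<comment> \<open>The third coordinate forces the exponent of the lift to be 1. The second
    coordinate then gives \<open>y = 0\<close>, after which the first is a congruence modulo
    \<open>p\<close>.\<close>
  obtain x y where xy: "int a = int p * x + int q' * y + int a'" "int b = int r * y + int b'"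
    using mem[of "(0, 0, 1)"] pos by (auto simp: sub_emb_def split: if_splits)
  have "y = 0" "b = b'"
    using int_residue_unique[OF xy(2)] less lpr by simp_all
  moreover have "a = a'"
    using int_residue_unique(2)[of "int a" "int p" x "int a'"] xy(1) \<open>y = 0\<close> less lpr by simp
  ultimately show ?thesis
    using lpr \<open>q = q'\<close> by simp
qed

section \<open>Existence of the normal form\<close>

lemma int_subgroup_UNIV:
  fixes P :: "int \<Rightarrow> bool"
  assumes diff: "\<And>x y. \<lbrakk>P x; P y\<rbrakk> \<Longrightarrow> P (x - y)" and "P 1"
  shows "P x"
proof -
  have zero: "P 0"
    using diff[OF assms(2) assms(2)] by simp
  have add: "P (x + 1)" if "P x" for x
    using diff[OF that diff[OF zero \<open>P 1\<close>]] by simp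
  show ?thesis
    by (induction x rule: int_induct[of _ 0]) (use zero add diff \<open>P 1\<close> in auto)
qed

text \<open>\<open>p\<close> generates the intersection of \<Delta> with the first axis,
  \<open>r\<close> the second coordinates of its elements with last coordinate 0, and
  \<open>l\<close> its projection to the last coordinate. Elements of \<Delta> over \<open>r\<close>
  and \<open>l\<close> are then reduced modulo the previous generators to give \<open>q\<close>,
  \<open>a\<close> and \<open>b\<close>.\<close>

lemma finite_index_sub_emb:
  assumes sub: "subgroup \<Delta> (amph 1)" and fin: "finite (rcosets\<^bsub>amph 1\<^esub> \<Delta>)"
  obtains l p r q a b :: nat where "l > 0" "p > 0" "r > 0" "q < p" "a < p" "b < r"
    "odd l \<longrightarrow> int p dvd int r - 2 * int q" "\<Delta> = range (sub_emb (int l) (int p) (int r) (int q) (int a) (int b))"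
proof -
  interpret G: group "amph 1" by (rule group_amph)
  interpret \<Delta>: subgroup \<Delta> "amph 1" by fact
  have ratio: "g \<otimes>\<^bsub>amph 1\<^esub> inv\<^bsub>amph 1\<^esub> h \<in> \<Delta>" if "g \<in> \<Delta>" "h \<in> \<Delta>" for g h
    using that by simp
  \<comment> \<open>Finite index puts a positive power of each coordinate generator into \<Delta>,
    so the three subgroups of \<int> below are nonzero.\<close>
  have power: "\<exists>k :: nat. k > 0 \<and> g [^]\<^bsub>amph 1\<^esub> int k \<in> \<Delta>" for g
    using G.finite_index_pow[OF sub fin, of g] by (metis UNIV_I carrier_amph int_pow_int)
  obtain kp kr kl :: nat where kp: "kp > 0" "(int kp, 0, 0) \<in> \<Delta>"
    and kr: "kr > 0" "(0, int kr, 0) \<in> \<Delta>" and kl: "kl > 0" "(0, 0, int kl) \<in> \<Delta>"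
    using power[of "(1, 0, 0)"] power[of "(0, 1, 0)"] power[of "(0, 0, 1)"] unfolding int_pow_amph
    by blast
  obtain p where p: "p > 0" "\<And>x. (x, 0, 0) \<in> \<Delta> \<longleftrightarrow> int p dvd x"
  proof (rule int_subgroup_multiples[of "\<lambda>x. (x, 0, 0) \<in> \<Delta>" "int kp"])
    show "(x - x', 0, 0) \<in> \<Delta>" if "(x, 0, 0) \<in> \<Delta>" "(x', 0, 0) \<in> \<Delta>" for x x'
      using ratio[OF that] by simp
  qed (use kp in auto)
  obtain r where r: "r > 0" "\<And>y. (\<exists>x. (x, y, 0) \<in> \<Delta>) \<longleftrightarrow> int r dvd y"
  proof (rule int_subgroup_multiples[of "\<lambda>y. \<exists>x. (x, y, 0) \<in> \<Delta>" "int kr"])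
    fix y y' assume "\<exists>x. (x, y, 0) \<in> \<Delta>" "\<exists>x. (x, y', 0) \<in> \<Delta>"
    then obtain x x' where "(x, y, 0) \<in> \<Delta>" "(x', y', 0) \<in> \<Delta>"
      by blast
    from ratio[OF this] show "\<exists>x. (x, y - y', 0) \<in> \<Delta>" by auto
  qed (use kr in auto)
  obtain l where l: "l > 0" "\<And>z. (\<exists>x y. (x, y, z) \<in> \<Delta>) \<longleftrightarrow> int l dvd z"
  proof (rule int_subgroup_multiples[of "\<lambda>z. \<exists>x y. (x, y, z) \<in> \<Delta>" "int kl"])
    fix z z' assume "\<exists>x y. (x, y, z) \<in> \<Delta>" "\<exists>x y. (x, y, z') \<in> \<Delta>"
    then obtain x y x' y' where "(x, y, z) \<in> \<Delta>" "(x', y', z') \<in> \<Delta>"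
      by blast
    from ratio[OF this] show "\<exists>x y. (x, y, z - z') \<in> \<Delta>"
      by (simp split: if_splits) blast+
  qed (use kl in auto)
  have shift_x: "(x', y, z) \<in> \<Delta>" if "(x, y, z) \<in> \<Delta>" "int p dvd x' - x" for x x' y z
    using \<Delta>.m_closed[of "(x' - x, 0, 0)" "(x, y, z)"] that p(2) by simp
  obtain q0 where q0: "(q0, int r, 0) \<in> \<Delta>"
    using r(2)[of "int r"] by auto
  define q where "q = nat (q0 mod int p)"
  have q_less: "q < p"
    using p(1) by (simp add: q_def nat_less_iff)
  have q: "(int q, int r, 0) \<in> \<Delta>"
    by (rule shift_x[OF q0]) (use p(1) in \<open>simp add: q_def mod_eq_dvd_iff[symmetric]\<close>)
  have qy: "(int q * y, int r * y, 0) \<in> \<Delta>" for y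
  proof (rule int_subgroup_UNIV[of "\<lambda>y. (int q * y, int r * y, 0) \<in> \<Delta>"])
    fix x x' assume "(int q * x, int r * x, 0) \<in> \<Delta>" "(int q * x', int r * x', 0) \<in> \<Delta>"
    from ratio[OF this] show "(int q * (x - x'), int r * (x - x'), 0) \<in> \<Delta>"
      by (simp add: algebra_simps)
  qed (use q in simp)
  obtain a0 b0 where ab0: "(a0, b0, int l) \<in> \<Delta>"
    using l(2)[of "int l"] by auto
  define b where "b = nat (b0 mod int r)"
  have b_less: "b < r"
    using r(1) by (simp add: b_def nat_less_iff)
  have b_eq: "int b = b0 - int r * (b0 div int r)"
    using r(1) by (simp add: b_def minus_mult_div_eq_mod)
  \<comment> \<open>Reducing \<open>b0\<close> modulo \<open>r\<close> by a lattice vector changes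
    the first coordinate, so the latter is reduced modulo \<open>p\<close> only afterwards.\<close>
  obtain a1 where a1: "(a1, int b, int l) \<in> \<Delta>"
    using \<Delta>.m_closed[OF qy[of "- (b0 div int r)"] ab0] by (auto simp: b_eq)
  define a where "a = nat (a1 mod int p)"
  have a_less: "a < p"
    using p(1) by (simp add: a_def nat_less_iff)
  have ab: "(int a, int b, int l) \<in> \<Delta>"
    by (rule shift_x[OF a1]) (use p(1) in \<open>simp add: a_def mod_eq_dvd_iff[symmetric]\<close>)
  have adm: "odd l \<longrightarrow> int p dvd int r - 2 * int q"
  proof
    assume "odd l"
    \<comment> \<open>Conjugating \<open>(q, r, 0)\<close> by the lift gives its reflection
      \<open>(r - q, r, 0)\<close>; the quotient of the two lies on the first axis, whose part in
      \<Delta> is generated by \<open>p\<close>.\<close>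
    have "((int a, int b, int l) \<otimes>\<^bsub>amph 1\<^esub> (int q, int r, 0)) \<otimes>\<^bsub>amph 1\<^esub> inv\<^bsub>amph 1\<^esub> (int a, int b, int l) \<in> \<Delta>"
      by (intro ratio \<Delta>.m_closed ab q)
    with \<open>odd l\<close> have "(int r - int q, int r, 0) \<in> \<Delta>"
      by simp
    from ratio[OF this q] show "int p dvd int r - 2 * int q"
      by (simp add: p(2))
  qed
  let ?f = "sub_emb (int l) (int p) (int r) (int q) (int a) (int b)"
  \<comment> \<open>By \<open>sub_emb_add\<close> the exponents \<open>w\<close> whose power of the
    lift lies in \<Delta> are closed under differences, and they include 1.\<close>
  have f_w: "?f (0, 0, w) \<in> \<Delta>" for w
  proof (rule int_subgroup_UNIV[of "\<lambda>w. ?f (0, 0, w) \<in> \<Delta>"])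
    fix x x' assume x: "?f (0, 0, x) \<in> \<Delta>" "?f (0, 0, x') \<in> \<Delta>"
    have "?f (0, 0, x) = ?f (0, 0, x - x') \<otimes>\<^bsub>amph 1\<^esub> ?f (0, 0, x')"
      using sub_emb_add[of "int l" "int p" "int r" "int q" "int a" "int b" "x - x'" x'] adm by simp
    then have "?f (0, 0, x - x') = ?f (0, 0, x) \<otimes>\<^bsub>amph 1\<^esub> inv\<^bsub>amph 1\<^esub> ?f (0, 0, x')"
      by (subst G.inv_solve_right) simp_all
    then show "?f (0, 0, x - x') \<in> \<Delta>"
      using ratio[OF x] by simp
  qed (use ab in \<open>simp add: sub_emb_simps\<close>)
  have pos: "int l > 0" "int p > 0" "int r > 0"
    using l(1) p(1) r(1) by simp_all
  have f_xy: "?f (x, y, 0) \<in> \<Delta>" for x y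
    using shift_x[OF qy[of y], of "int p * x + int q * y"] by (simp add: sub_emb_simps)
  have "?f g \<in> \<Delta>" for g
  proof -
    obtain x y w where g: "g = (x, y, w)" by (cases g)
    have "?f (x, y, 0) \<otimes>\<^bsub>amph 1\<^esub> ?f (0, 0, w) = ?f g"
      by (simp add: g sub_emb_def)
    then show ?thesis
      using \<Delta>.m_closed[OF f_xy f_w] by metis
  qed
  moreover have "g \<in> range ?f" if "g \<in> \<Delta>" for g
  proof -
    obtain x y w i j k where *: "0 \<le> i" "i < int p" "0 \<le> j" "j < int r" "0 \<le> k" "k < int l"
      "g = ?f (0, 0, w) \<otimes>\<^bsub>amph 1\<^esub> (?f (x, y, 0) \<otimes>\<^bsub>amph 1\<^esub> (i, j, k))"
      by (rule sub_emb_transversal[OF pos]) (rule that; assumption)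
    \<comment> \<open>Cancelling the two factors already known to lie in \<Delta> leaves the box
      representative in \<Delta>. Divisibility by \<open>l\<close>, \<open>r\<close> and
      \<open>p\<close>, used in this order, forces it to be trivial.\<close>
    have "inv\<^bsub>amph 1\<^esub> ?f (x, y, 0) \<otimes>\<^bsub>amph 1\<^esub> (inv\<^bsub>amph 1\<^esub> ?f (0, 0, w) \<otimes>\<^bsub>amph 1\<^esub> g) \<in> \<Delta>"
      using f_w f_xy \<open>g \<in> \<Delta>\<close> by simp
    also have "inv\<^bsub>amph 1\<^esub> ?f (x, y, 0) \<otimes>\<^bsub>amph 1\<^esub> (inv\<^bsub>amph 1\<^esub> ?f (0, 0, w) \<otimes>\<^bsub>amph 1\<^esub> g) = (i, j, k)"
      unfolding *(7) by (simp only: G.mult_inv_cancel_left carrier_amph UNIV_I)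
    finally have t: "(i, j, k) \<in> \<Delta>" .
    have small: "z = 0" if "0 \<le> z" "z < m" "m dvd z" for z m :: int
      using that zdvd_not_zless[of z m] by linarith
    have "int l dvd k"
      using l(2) t by blast
    then have "k = 0"
      by (rule small[OF *(5,6)])
    then have "int r dvd j"
      using r(2) t by blast
    then have "j = 0"
      by (rule small[OF *(3,4)])
    then have "int p dvd i"
      using p(2) t \<open>k = 0\<close> by blast
    then have "i = 0"
      by (rule small[OF *(1,2)])
    have "g = ?f (0, 0, w) \<otimes>\<^bsub>amph 1\<^esub> ?f (x, y, 0)"
      using *(7) G.r_one[of "?f (x, y, 0)"] by (simp only: \<open>i = 0\<close> \<open>j = 0\<close> \<open>k = 0\<close> one_amph carrier_amph UNIV_I)
    moreover have "subgroup (range ?f) (amph 1)"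
      using subgroup_sub_emb adm by simp
    ultimately show ?thesis
      using subgroup.m_closed by fastforce
  qed
  ultimately have "\<Delta> = range ?f" by blast
  then show thesis
    by (rule that[OF l(1) p(1) r(1) q_less a_less b_less adm])
qed

section \<open>Transfer along isomorphisms\<close>

lemma iso_restrict:
  assumes "f \<in> iso G H" "\<Delta> \<subseteq> carrier G"
  shows "G\<lparr>carrier := \<Delta>\<rparr> \<cong> H\<lparr>carrier := f ` \<Delta>\<rparr>"
proof (rule is_isoI, rule isoI)
  show "f \<in> hom (G\<lparr>carrier := \<Delta>\<rparr>) (H\<lparr>carrier := f ` \<Delta>\<rparr>)"
    using assms by (auto simp: iso_def hom_def)
  have "inj_on f \<Delta>"
    using assms by (auto simp: iso_def bij_betw_def intro: inj_on_subset)
  then show "bij_betw f (carrier (G\<lparr>carrier := \<Delta>\<rparr>)) (carrier (H\<lparr>carrier := f ` \<Delta>\<rparr>))"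
    by (simp add: bij_betw_def)
qed

lemma iso_image_subgroups_of_index:
  assumes f: "f \<in> iso G H" and "group G" "group H" and \<Delta>: "\<Delta> \<in> subgroups_of_index G n"
  shows "f ` \<Delta> \<in> subgroups_of_index H n"
proof -
  have hom: "f \<in> hom G H" and inj: "inj_on f (carrier G)" and surj: "f ` carrier G = carrier H"
    using f by (auto simp: iso_def bij_betw_def)
  have sub: "subgroup \<Delta> G" and card: "card (rcosets\<^bsub>G\<^esub> \<Delta>) = n"
    using \<Delta> by (auto simp: subgroups_of_index_def)
  have \<Delta>_sub: "\<Delta> \<subseteq> carrier G"
    by (rule subgroup.subset[OF sub])
  have "group_hom G H f"
    using assms(2,3) hom by (simp add: group_hom_def group_hom_axioms_def)
  then have sub': "subgroup (f ` \<Delta>) H"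
    by (rule group_hom.subgroup_img_is_subgroup[OF _ sub])
  have coset: "f ` (\<Delta> #>\<^bsub>G\<^esub> g) = f ` \<Delta> #>\<^bsub>H\<^esub> f g" if "g \<in> carrier G" for g
    using \<Delta>_sub that by (force simp: r_coset_def hom_mult[OF hom] image_iff)
  have "rcosets\<^bsub>H\<^esub> (f ` \<Delta>) = (\<lambda>g. f ` \<Delta> #>\<^bsub>H\<^esub> g) ` f ` carrier G"
    unfolding surj by (auto simp: RCOSETS_def)
  also have "\<dots> = (`) f ` (\<lambda>g. \<Delta> #>\<^bsub>G\<^esub> g) ` carrier G"
    by (simp add: image_image coset)
  also have "(\<lambda>g. \<Delta> #>\<^bsub>G\<^esub> g) ` carrier G = rcosets\<^bsub>G\<^esub> \<Delta>"
    by (auto simp: RCOSETS_def)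
  finally have "rcosets\<^bsub>H\<^esub> (f ` \<Delta>) = (`) f ` (rcosets\<^bsub>G\<^esub> \<Delta>)" .
  moreover have "inj_on ((`) f) (rcosets\<^bsub>G\<^esub> \<Delta>)"
  proof (rule inj_on_subset[OF inj_on_image_Pow[OF inj]])
    show "rcosets\<^bsub>G\<^esub> \<Delta> \<subseteq> Pow (carrier G)"
      using group.rcosets_part_G[OF assms(2) sub] by blast
  qed
  ultimately show ?thesis
    using sub' card by (simp add: subgroups_of_index_def card_image)
qed

lemma iso_bij_betw_subgroups_of_index:
  assumes f: "f \<in> iso G H" and "group G" "group H"
  shows "bij_betw ((`) f) (subgroups_of_index G n) (subgroups_of_index H n)"
proof (rule bij_betw_imageI)
  have bij: "inj_on f (carrier G)" "f ` carrier G = carrier H"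
    using f by (auto simp: iso_def bij_betw_def)
  have sub: "\<Delta> \<subseteq> carrier K" if "\<Delta> \<in> subgroups_of_index K n" for \<Delta> and K :: "('x, 'y) monoid_scheme"
    using that subgroup.subset by (auto simp: subgroups_of_index_def)
  show "inj_on ((`) f) (subgroups_of_index G n)"
    by (rule inj_on_subset[OF inj_on_image_Pow[OF bij(1)]]) (use sub in blast)
  show "(`) f ` subgroups_of_index G n = subgroups_of_index H n"
  proof
    show "(`) f ` subgroups_of_index G n \<subseteq> subgroups_of_index H n"
      using iso_image_subgroups_of_index[OF assms] by blast
    show "subgroups_of_index H n \<subseteq> (`) f ` subgroups_of_index G n"
    proof
      fix \<Delta> assume \<Delta>: "\<Delta> \<in> subgroups_of_index H n"
      let ?g = "inv_into (carrier G) f"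
      have "?g \<in> iso H G"
        by (rule group.iso_set_sym[OF assms(2) f])
      then have "?g ` \<Delta> \<in> subgroups_of_index G n"
        by (rule iso_image_subgroups_of_index[OF _ assms(3,2) \<Delta>])
      moreover have "f ` ?g ` \<Delta> = \<Delta>"
        by (rule image_inv_into_cancel[OF bij(2) sub[OF \<Delta>]])
      ultimately show "\<Delta> \<in> (`) f ` subgroups_of_index G n"
        by (metis imageI)
    qed
  qed
qed

lemma group_subgroups_of_index:
  "\<lbrakk>group G; \<Delta> \<in> subgroups_of_index G n\<rbrakk> \<Longrightarrow> group (G\<lparr>carrier := \<Delta>\<rparr>)"
  by (simp add: subgroups_of_index_def subgroup.subgroup_is_group)

lemma is_iso_cong:
  assumes "G \<cong> H" "K \<cong> L" "group G" "group K"
  shows "G \<cong> K \<longleftrightarrow> H \<cong> L"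
  using assms by (meson group.iso_sym iso_trans)

text \<open>This moves the counts from the presented groups to the models: direct image under an
  isomorphism is a bijection on subgroups of index \<open>n\<close> and preserves their isomorphism
  types.\<close>

lemma num_subgroups_cong:
  assumes "K \<cong> L" "G \<cong> H" "group K" "group G" "group H"
  shows "num_subgroups K G n = num_subgroups L H n"
proof -
  obtain f where f: "f \<in> iso G H"
    using assms(2) by (auto simp: is_iso_def)
  let ?A = "subgroups_of_index G n" and ?B = "subgroups_of_index H n"
  have bij: "bij_betw ((`) f) ?A ?B"
    by (rule iso_bij_betw_subgroups_of_index[OF f assms(4,5)])
  have iff: "G\<lparr>carrier := \<Delta>\<rparr> \<cong> K \<longleftrightarrow> H\<lparr>carrier := f ` \<Delta>\<rparr> \<cong> L" if "\<Delta> \<in> ?A" for \<Delta>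
  proof (rule is_iso_cong[OF _ assms(1) group_subgroups_of_index[OF assms(4) that] assms(3)])
    show "G\<lparr>carrier := \<Delta>\<rparr> \<cong> H\<lparr>carrier := f ` \<Delta>\<rparr>"
      using iso_restrict[OF f] that subgroup.subset by (auto simp: subgroups_of_index_def)
  qed
  have "bij_betw ((`) f) {\<Delta> \<in> ?A. G\<lparr>carrier := \<Delta>\<rparr> \<cong> K} {\<Delta> \<in> ?B. H\<lparr>carrier := \<Delta>\<rparr> \<cong> L}"
  proof (rule bij_betw_subset[OF bij])
    have "?B = (`) f ` ?A"
      using bij by (simp add: bij_betw_def)
    then show "(`) f ` {\<Delta> \<in> ?A. G\<lparr>carrier := \<Delta>\<rparr> \<cong> K} = {\<Delta> \<in> ?B. H\<lparr>carrier := \<Delta>\<rparr> \<cong> L}"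
      using iff by auto
  qed auto
  then show ?thesis
    unfolding num_subgroups_def by (rule bij_betw_same_card)
qed

section \<open>Counting subgroups\<close>

definition factor_triples :: "nat \<Rightarrow> (nat \<times> nat \<times> nat) set"
  where "factor_triples n = {(l, p, r). l * p * r = n}"

lemma factor_triples_pos:
  assumes "(l, p, r) \<in> factor_triples n" "n > 0"
  shows "l > 0" "p > 0" "r > 0"
  using assms by (auto simp: factor_triples_def)

lemma finite_factor_triples:
  assumes "n > 0"
  shows "finite (factor_triples n)"
proof (rule finite_subset)
  show "factor_triples n \<subseteq> {..n} \<times> {..n} \<times> {..n}"
    using assms by (auto simp: factor_triples_def intro: dvd_imp_le)
qed simp

text \<open>The choices left after \<open>(l, p, r)\<close>: \<open>q\<close> completes the lattice,
  subject to invariance, and \<open>(a, b)\<close> runs through representatives of \<int>^2 modulo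
  that lattice.\<close>

definition lattice_residues :: "nat \<times> nat \<times> nat \<Rightarrow> (nat \<times> nat \<times> nat) set"
  where "lattice_residues = (\<lambda>(l, p, r).
    {q. q < p \<and> (odd l \<longrightarrow> int p dvd int r - 2 * int q)} \<times> {..<p} \<times> {..<r})"

definition param_subgroup :: "(nat \<times> nat \<times> nat) \<times> (nat \<times> nat \<times> nat) \<Rightarrow> (int \<times> int \<times> int) set"
  where "param_subgroup = (\<lambda>((l, p, r), (q, a, b)).
    range (sub_emb (int l) (int p) (int r) (int q) (int a) (int b)))"

text \<open>Existence and uniqueness of the normal form, together with the index formula, turn
  counting subgroups into counting parameters.\<close>

lemma bij_betw_param_subgroup:
  assumes n: "n > 0"
  shows "bij_betw param_subgroup (Sigma (factor_triples n) lattice_residues) (subgroups_of_index (amph 1) n)"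
proof (rule bij_betw_imageI)
  show "inj_on param_subgroup (Sigma (factor_triples n) lattice_residues)"
  proof (rule inj_onI)
    fix s t assume st: "s \<in> Sigma (factor_triples n) lattice_residues"
      "t \<in> Sigma (factor_triples n) lattice_residues" "param_subgroup s = param_subgroup t"
    obtain l p r q a b l' p' r' q' a' b'
      where s: "s = ((l, p, r), (q, a, b))" and t: "t = ((l', p', r'), (q', a', b'))"
      by (metis surj_pair)
    have "l = l' \<and> p = p' \<and> r = r' \<and> q = q' \<and> a = a' \<and> b = b'"
    proof (rule sub_emb_range_eqD)
      have "(l, p, r) \<in> factor_triples n" "(l', p', r') \<in> factor_triples n"
        using st(1,2) by (auto simp: s t)
      then show "l > 0" "p > 0" "r > 0" "l' > 0" "p' > 0" "r' > 0"
        using factor_triples_pos n by blast+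
      show "q < p" "a < p" "b < r" "q' < p'" "a' < p'" "b' < r'"
        using st(1,2) by (auto simp: s t lattice_residues_def)
      show "range (sub_emb (int l) (int p) (int r) (int q) (int a) (int b)) =
          range (sub_emb (int l') (int p') (int r') (int q') (int a') (int b'))"
        using st(3) by (simp add: s t param_subgroup_def)
    qed
    then show "s = t"
      by (simp add: s t)
  qed
  show "param_subgroup ` Sigma (factor_triples n) lattice_residues = subgroups_of_index (amph 1) n"
  proof
    show "param_subgroup ` Sigma (factor_triples n) lattice_residues \<subseteq> subgroups_of_index (amph 1) n"
    proof
      fix \<Delta> assume "\<Delta> \<in> param_subgroup ` Sigma (factor_triples n) lattice_residues"
      then obtain t where t: "t \<in> Sigma (factor_triples n) lattice_residues" "\<Delta> = param_subgroup t"
        by blast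
      obtain l p r q a b where "t = ((l, p, r), (q, a, b))"
        by (metis surj_pair)
      then have \<Delta>: "\<Delta> = range (sub_emb (int l) (int p) (int r) (int q) (int a) (int b))"
        "l * p * r = n" "odd l \<longrightarrow> int p dvd int r - 2 * int q"
        using t by (auto simp: factor_triples_def lattice_residues_def param_subgroup_def)
      have "l > 0" "p > 0" "r > 0"
        using \<Delta>(2) n factor_triples_pos[of l p r n] by (simp_all add: factor_triples_def)
      then have "card (rcosets\<^bsub>amph 1\<^esub> \<Delta>) = n"
        using card_rcosets_sub_emb[of l p r "int q" "int a" "int b"] \<Delta> by simp
      moreover have "subgroup \<Delta> (amph 1)"
        unfolding \<Delta>(1) by (rule subgroup_sub_emb) (use \<Delta>(3) in simp)
      ultimately show "\<Delta> \<in> subgroups_of_index (amph 1) n"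
        by (simp add: subgroups_of_index_def)
    qed
    show "subgroups_of_index (amph 1) n \<subseteq> param_subgroup ` Sigma (factor_triples n) lattice_residues"
    proof
      fix \<Delta> assume "\<Delta> \<in> subgroups_of_index (amph 1) n"
      then have \<Delta>: "subgroup \<Delta> (amph 1)" "card (rcosets\<^bsub>amph 1\<^esub> \<Delta>) = n"
        by (auto simp: subgroups_of_index_def)
      then have "finite (rcosets\<^bsub>amph 1\<^esub> \<Delta>)"
        using n card_ge_0_finite by auto
      then obtain l p r q a b :: nat where *: "l > 0" "p > 0" "r > 0" "q < p" "a < p" "b < r"
        "odd l \<longrightarrow> int p dvd int r - 2 * int q"
        "\<Delta> = range (sub_emb (int l) (int p) (int r) (int q) (int a) (int b))"
        by (rule finite_index_sub_emb[OF \<Delta>(1)]) (rule that; assumption)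
      then have "l * p * r = n"
        using card_rcosets_sub_emb[of l p r "int q" "int a" "int b"] \<Delta>(2) by simp
      then have "((l, p, r), (q, a, b)) \<in> Sigma (factor_triples n) lattice_residues"
        using * by (auto simp: factor_triples_def lattice_residues_def)
      moreover have "\<Delta> = param_subgroup ((l, p, r), (q, a, b))"
        using * by (simp add: param_subgroup_def)
      ultimately show "\<Delta> \<in> param_subgroup ` Sigma (factor_triples n) lattice_residues"
        by blast
    qed
  qed
qed

lemma param_subgroup_type:
  assumes "n > 0" "((l, p, r), (q, a, b)) \<in> Sigma (factor_triples n) lattice_residues"
  shows "even l \<Longrightarrow> (amph 1)\<lparr>carrier := param_subgroup ((l, p, r), (q, a, b))\<rparr> \<cong> Z3"
    and "odd l \<Longrightarrow> (amph 1)\<lparr>carrier := param_subgroup ((l, p, r), (q, a, b))\<rparr> \<cong>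
      amph ((int r - 2 * int q) div int p mod 2)"
proof -
  have pos: "int l \<noteq> 0" "int p \<noteq> 0" "int r \<noteq> 0"
    using factor_triples_pos[of l p r n] assms by simp_all
  have adm: "int p dvd int r - 2 * int q" if "odd l"
    using assms(2) that by (auto simp: lattice_residues_def)
  show "(amph 1)\<lparr>carrier := param_subgroup ((l, p, r), (q, a, b))\<rparr> \<cong> Z3" if "even l"
    unfolding param_subgroup_def prod.case
    by (rule group.iso_sym[OF group_Z3 Z3_iso_sub_emb]) (use pos that in simp_all)
  show "(amph 1)\<lparr>carrier := param_subgroup ((l, p, r), (q, a, b))\<rparr> \<cong>
      amph ((int r - 2 * int q) div int p mod 2)" if "odd l"
    unfolding param_subgroup_def prod.case
    by (rule group.iso_sym[OF group_amph amph_iso_sub_emb]) (use pos that adm in simp_all)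
qed

text \<open>The isomorphism type depends only on \<open>l\<close>, \<open>p\<close>,
  \<open>r\<close> and \<open>q\<close>, so the free choices of \<open>a\<close> and
  \<open>b\<close> contribute the factor \<open>p * r\<close>. The predicate \<open>Q\<close>
  encodes which parameters give the type \<open>K\<close>.\<close>

lemma num_subgroups_amph_1:
  assumes n: "n > 0"
    and type: "\<And>l p r q a b. \<lbrakk>l * p * r = n; odd l \<longrightarrow> int p dvd int r - 2 * int q\<rbrakk> \<Longrightarrow>
      (if even l then Z3 else amph ((int r - 2 * int q) div int p mod 2)) \<cong> K \<longleftrightarrow> Q l p r q"
  shows "num_subgroups K (amph 1) n = (\<Sum>(l, p, r)\<in>factor_triples n.
    card {q. q < p \<and> (odd l \<longrightarrow> int p dvd int r - 2 * int q) \<and> Q l p r q} * (p * r))"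
proof -
  let ?S = "Sigma (factor_triples n) lattice_residues"
  let ?T = "Sigma (factor_triples n) (\<lambda>(l, p, r).
    {q. q < p \<and> (odd l \<longrightarrow> int p dvd int r - 2 * int q) \<and> Q l p r q} \<times> {..<p} \<times> {..<r})"
  have T: "t \<in> ?T \<longleftrightarrow> t \<in> ?S \<and> (amph 1)\<lparr>carrier := param_subgroup t\<rparr> \<cong> K" for t
  proof -
    obtain l p r q a b where t: "t = ((l, p, r), (q, a, b))"
      by (metis surj_pair)
    show ?thesis
    proof (cases "t \<in> ?S")
      case True
      then have lpr: "l * p * r = n" "odd l \<longrightarrow> int p dvd int r - 2 * int q"
        by (auto simp: t factor_triples_def lattice_residues_def)
      let ?M = "if even l then Z3 else amph ((int r - 2 * int q) div int p mod 2)"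
      have iso: "(amph 1)\<lparr>carrier := param_subgroup t\<rparr> \<cong> ?M"
        using param_subgroup_type[OF n True[unfolded t]] unfolding t by (cases "even l") simp_all
      have "param_subgroup t \<in> subgroups_of_index (amph 1) n"
        using bij_betw_param_subgroup[OF n] True by (auto simp: bij_betw_def)
      then have "group ((amph 1)\<lparr>carrier := param_subgroup t\<rparr>)"
        by (rule group_subgroups_of_index[OF group_amph])
      then have "?M \<cong> (amph 1)\<lparr>carrier := param_subgroup t\<rparr>"
        by (rule group.iso_sym[OF _ iso])
      then have "(amph 1)\<lparr>carrier := param_subgroup t\<rparr> \<cong> K \<longleftrightarrow> ?M \<cong> K"
        using iso_trans[OF iso] iso_trans by blast
      also have "\<dots> \<longleftrightarrow> Q l p r q"
        by (rule type[OF lpr])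
      finally show ?thesis
        using True by (auto simp: t lattice_residues_def)
    next
      case False
      then show ?thesis
        by (auto simp: t lattice_residues_def)
    qed
  qed
  have bij: "bij_betw param_subgroup ?S (subgroups_of_index (amph 1) n)"
    by (rule bij_betw_param_subgroup[OF n])
  have "bij_betw param_subgroup ?T {\<Delta> \<in> subgroups_of_index (amph 1) n. (amph 1)\<lparr>carrier := \<Delta>\<rparr> \<cong> K}"
  proof (rule bij_betw_subset[OF bij])
    show "?T \<subseteq> ?S"
      using T by blast
    have "?T = {t \<in> ?S. (amph 1)\<lparr>carrier := param_subgroup t\<rparr> \<cong> K}"
      using T by blast
    moreover have "param_subgroup ` ?S = subgroups_of_index (amph 1) n"
      using bij by (simp add: bij_betw_def)
    moreover have "f ` {t \<in> A. P (f t)} = {\<Delta> \<in> f ` A. P \<Delta>}" for f :: "'x \<Rightarrow> 'y" and A P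
      by blast
    from this[of param_subgroup ?S "\<lambda>\<Delta>. (amph 1)\<lparr>carrier := \<Delta>\<rparr> \<cong> K"]
    have "param_subgroup ` {t \<in> ?S. (amph 1)\<lparr>carrier := param_subgroup t\<rparr> \<cong> K} =
        {\<Delta> \<in> param_subgroup ` ?S. (amph 1)\<lparr>carrier := \<Delta>\<rparr> \<cong> K}" .
    ultimately show "param_subgroup ` ?T = {\<Delta> \<in> subgroups_of_index (amph 1) n. (amph 1)\<lparr>carrier := \<Delta>\<rparr> \<cong> K}"
      by (simp only:)
  qed
  then have "num_subgroups K (amph 1) n = card ?T"
    unfolding num_subgroups_def using bij_betw_same_card by fastforce
  also have "\<dots> = (\<Sum>(l, p, r)\<in>factor_triples n.
    card {q. q < p \<and> (odd l \<longrightarrow> int p dvd int r - 2 * int q) \<and> Q l p r q} * (p * r))"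
    by (subst card_SigmaI) (simp_all add: finite_factor_triples[OF n] split_beta card_cartesian_product)
  finally show ?thesis .
qed

text \<open>Divisibility by \<open>p\<close> with a quotient of parity \<open>e\<close> is the
  single congruence \<open>2 q = r - e p\<close> modulo \<open>2 p\<close>. It has no solution if
  the right side is odd; otherwise halving it determines \<open>q\<close> modulo
  \<open>p\<close>.\<close>

lemma card_lattice_residues_parity:
  fixes p r e :: nat
  assumes "p > 0" "e < 2"
  shows "card {q. q < p \<and> int p dvd int r - 2 * int q \<and> (int r - 2 * int q) div int p mod 2 = int e} =
    (if even (r + e * p) then 1 else 0)"
proof -
  have iff: "int p dvd int r - 2 * int q \<and> (int r - 2 * int q) div int p mod 2 = int e \<longleftrightarrow>
      2 * int p dvd int r - int e * int p - 2 * int q" for q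
  proof
    assume *: "int p dvd int r - 2 * int q \<and> (int r - 2 * int q) div int p mod 2 = int e"
    then obtain t where t: "int r - 2 * int q = int p * t"
      by (elim conjE dvdE)
    then have "t mod 2 = int e"
      using * assms(1) by simp
    then have "t = 2 * (t div 2) + int e"
      by presburger
    then have "int r - 2 * int q = int p * (2 * (t div 2) + int e)"
      using t by metis
    then have "int r - int e * int p - 2 * int q = 2 * int p * (t div 2)"
      by (simp add: algebra_simps)
    then show "2 * int p dvd int r - int e * int p - 2 * int q"
      by (metis dvd_triv_left)
  next
    assume "2 * int p dvd int r - int e * int p - 2 * int q"
    then obtain k where "int r - int e * int p - 2 * int q = 2 * int p * k"
      by (elim dvdE)
    then have t: "int r - 2 * int q = int p * (2 * k + int e)"
      by (simp add: algebra_simps)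
    show "int p dvd int r - 2 * int q \<and> (int r - 2 * int q) div int p mod 2 = int e"
      unfolding t using assms by simp
  qed
  show ?thesis
  proof (cases "even (r + e * p)")
    case True
    then have "even (int (r + e * p))"
      by (simp only: even_of_nat)
    then have "even (int r - int e * int p)"
      by simp
    then obtain s where s: "int r - int e * int p = 2 * s"
      by (rule evenE)
    have "2 * int p dvd int r - int e * int p - 2 * int q \<longleftrightarrow> int p dvd s - int q" for q
      unfolding s right_diff_distrib[symmetric] by (subst dvd_mult_cancel_left) simp
    then have "{q. q < p \<and> int p dvd int r - 2 * int q \<and> (int r - 2 * int q) div int p mod 2 = int e} =
        {q. q < p \<and> int p dvd s - int q}"
      using iff by simp
    also have "\<dots> = {nat (s mod int p)}"
    proof -
      have "int p dvd s - int q \<longleftrightarrow> q = nat (s mod int p)" if "q < p" for q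
      proof -
        have "int p dvd s - int q \<longleftrightarrow> s mod int p = int q mod int p"
          by (rule mod_eq_dvd_iff[symmetric])
        also have "int q mod int p = int q"
          using that by simp
        also have "s mod int p = int q \<longleftrightarrow> q = nat (s mod int p)"
          using assms(1) by auto
        finally show ?thesis .
      qed
      moreover have "nat (s mod int p) < p"
        using assms(1) by (simp add: nat_less_iff)
      ultimately show ?thesis by auto
    qed
    finally show ?thesis
      using True by simp
  next
    case False
    have "\<not> 2 * int p dvd int r - int e * int p - 2 * int q" for q
    proof
      assume "2 * int p dvd int r - int e * int p - 2 * int q"
      then have "even (int r - int e * int p - 2 * int q)"
        by (rule dvd_mult_left)
      then have "even (int (r + e * p))"
        by simp
      then show False
        using False by (simp only: even_of_nat)
    qed
    then have "{q. q < p \<and> int p dvd int r - 2 * int q \<and> (int r - 2 * int q) div int p mod 2 = int e} = {}"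
      using iff by blast
    then show ?thesis
      using False by (simp only: if_False card.empty)
  qed
qed

text \<open>For even \<open>l\<close> every \<open>q\<close> below \<open>p\<close> is admissible,
  which gives the extra factor \<open>p\<close>; for odd \<open>l\<close> the subgroup is not
  abelian.\<close>

lemma num_subgroups_Z3_amph_1:
  assumes n: "n > 0"
  shows "num_subgroups Z3 (amph 1) n = (\<Sum>(l, p, r)\<in>factor_triples n. if even l then p * (p * r) else 0)"
proof -
  have "num_subgroups Z3 (amph 1) n = (\<Sum>(l, p, r)\<in>factor_triples n.
      card {q. q < p \<and> (odd l \<longrightarrow> int p dvd int r - 2 * int q) \<and> even l} * (p * r))"
  proof (rule num_subgroups_amph_1[OF n])
    show "(if even l then Z3 else amph ((int r - 2 * int q) div int p mod 2)) \<cong> Z3 \<longleftrightarrow> even l"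
      for l p r q :: nat
      using not_Z3_iso_amph group.iso_sym[OF group_amph] by (auto simp: iso_refl)
  qed
  also have "\<dots> = (\<Sum>(l, p, r)\<in>factor_triples n. if even l then p * (p * r) else 0)"
    by (rule sum.cong) auto
  finally show ?thesis .
qed

lemma amph_iso_amph_iff:
  assumes "d \<in> {0, 1}" "e \<in> {0, 1}"
  shows "amph d \<cong> amph e \<longleftrightarrow> d = e"
proof
  show "amph d \<cong> amph e \<Longrightarrow> d = e"
    using assms not_amph_0_iso_amph_1 group.iso_sym[OF group_amph] by blast
qed (simp add: iso_refl)

lemma num_subgroups_amph_amph_1:
  assumes n: "n > 0" and e: "e < 2"
  shows "num_subgroups (amph (int e)) (amph 1) n =
    (\<Sum>(l, p, r)\<in>factor_triples n. if odd l \<and> even (r + e * p) then p * r else 0)"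
proof -
  have "num_subgroups (amph (int e)) (amph 1) n = (\<Sum>(l, p, r)\<in>factor_triples n.
      card {q. q < p \<and> (odd l \<longrightarrow> int p dvd int r - 2 * int q) \<and>
        odd l \<and> (int r - 2 * int q) div int p mod 2 = int e} * (p * r))"
  proof (rule num_subgroups_amph_1[OF n])
    fix l p r q :: nat
    have "(int r - 2 * int q) div int p mod 2 \<in> {0, 1}" "int e \<in> {0, 1}"
      using e by auto
    then show "(if even l then Z3 else amph ((int r - 2 * int q) div int p mod 2)) \<cong> amph (int e) \<longleftrightarrow>
        odd l \<and> (int r - 2 * int q) div int p mod 2 = int e"
      using not_Z3_iso_amph amph_iso_amph_iff by simp
  qed
  also have "\<dots> = (\<Sum>(l, p, r)\<in>factor_triples n. if odd l \<and> even (r + e * p) then p * r else 0)"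
  proof (rule sum.cong[OF HOL.refl])
    fix t assume "t \<in> factor_triples n"
    obtain l p r where t: "t = (l, p, r)"
      by (cases t)
    have "p > 0"
      using factor_triples_pos(2)[of l p r n] \<open>t \<in> factor_triples n\<close> n by (simp add: t)
    from card_lattice_residues_parity[OF this e, of r]
    show "(case t of (l, p, r) \<Rightarrow> card {q. q < p \<and> (odd l \<longrightarrow> int p dvd int r - 2 * int q) \<and>
        odd l \<and> (int r - 2 * int q) div int p mod 2 = int e} * (p * r)) =
      (case t of (l, p, r) \<Rightarrow> if odd l \<and> even (r + e * p) then p * r else 0)"
      by (cases "even l"; cases "even (r + e * p)") (simp_all only: t prod.case, simp_all)
  qed
  finally show ?thesis .
qed

section \<open>Divisor sums as sums over factor triples\<close>

lemma sigma1_sum_eq_triples: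
  fixes c n :: nat
  assumes "n > 0" "c > 0"
  shows "(\<Sum>r | c * r dvd n \<and> Q r. r * sigma1 (n div (c * r))) =
    (\<Sum>(l, p, r)\<in>factor_triples n. if c dvd l \<and> Q r then p * r else 0)"
proof -
  have fin: "finite {r. c * r dvd n \<and> Q r}"
    by (rule finite_subset[of _ "{..n}"]) (use assms in \<open>auto dest!: dvd_mult_right intro: dvd_imp_le\<close>)
  have pos: "n div (c * r) > 0" if "c * r dvd n" for r
    using that assms by (auto elim!: dvdE)
  have "(\<Sum>r | c * r dvd n \<and> Q r. r * sigma1 (n div (c * r))) =
      (\<Sum>r | c * r dvd n \<and> Q r. \<Sum>p | p dvd n div (c * r). p * r)"
    by (simp add: sigma1_def sum_distrib_left mult.commute)
  also have "\<dots> = (\<Sum>(r, p)\<in>(SIGMA r:{r. c * r dvd n \<and> Q r}. {p. p dvd n div (c * r)}). p * r)"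
    by (rule sum.Sigma[OF fin]) (use pos in \<open>auto intro: finite_divisors_nat\<close>)
  also have "\<dots> = (\<Sum>(l, p, r)\<in>{t \<in> factor_triples n. c dvd fst t \<and> Q (snd (snd t))}. p * r)"
  \<comment> \<open>Expanding \<open>sigma1\<close> supplies the factor \<open>p\<close>. The
    remaining factor \<open>l\<close> is the quotient of \<open>n\<close> by \<open>p * r\<close>,
    and it is \<open>c\<close> times an integer because \<open>p\<close> divides the quotient of
    \<open>n\<close> by \<open>c * r\<close>.\<close>
  proof (rule sum.reindex_bij_witness[where i = "\<lambda>(l, p, r). (r, p)"
        and j = "\<lambda>(r, p). (c * (n div (c * r) div p), p, r)"])
    fix s assume "s \<in> (SIGMA r:{r. c * r dvd n \<and> Q r}. {p. p dvd n div (c * r)})"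
    then obtain r p where s: "s = (r, p)" "c * r dvd n" "Q r" "p dvd n div (c * r)"
      by auto
    have "c * (n div (c * r) div p) * p * r = (n div (c * r) div p * p) * (c * r)"
      by (simp only: mult_ac)
    also have "\<dots> = n"
      by (simp only: dvd_div_mult_self[OF s(4)] dvd_div_mult_self[OF s(2)])
    finally have "c * (n div (c * r) div p) * p * r = n" .
    then show "(case s of (r, p) \<Rightarrow> (c * (n div (c * r) div p), p, r)) \<in>
        {t \<in> factor_triples n. c dvd fst t \<and> Q (snd (snd t))}"
      using s by (simp add: factor_triples_def)
  next
    fix t assume t: "t \<in> {t \<in> factor_triples n. c dvd fst t \<and> Q (snd (snd t))}"
    obtain l p r where lpr: "t = (l, p, r)"
      by (cases t)
    with t obtain k where "l = c * k"
      by (auto elim: dvdE)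
    with t lpr have *: "t = (c * k, p, r)" "n = c * k * p * r" "Q r"
      by (auto simp: factor_triples_def)
    have n_eq: "n = c * r * (p * k)"
      by (simp add: *(2) mult_ac)
    then have div: "n div (c * r) = p * k" and "p > 0"
      using assms by auto
    show "(case case t of (l, p, r) \<Rightarrow> (r, p) of (r, p) \<Rightarrow> (c * (n div (c * r) div p), p, r)) = t"
      using \<open>p > 0\<close> by (simp add: *(1) div)
    show "(case t of (l, p, r) \<Rightarrow> (r, p)) \<in> (SIGMA r:{r. c * r dvd n \<and> Q r}. {p. p dvd n div (c * r)})"
      using *(1,3) n_eq div by auto
  qed auto
  also have "\<dots> = (\<Sum>(l, p, r)\<in>factor_triples n. if c dvd l \<and> Q r then p * r else 0)"
    by (subst sum.inter_filter[OF finite_factor_triples[OF assms(1)]])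
      (rule sum.cong, auto split: prod.split)
  finally show ?thesis .
qed

lemma sum_even_reindex:
  fixes f :: "nat \<Rightarrow> nat"
  shows "(\<Sum>k | 2 * c * k dvd n. f (2 * k)) = (\<Sum>r | c * r dvd n \<and> even r. f r)"
  by (rule sum.reindex_bij_witness[where i = "\<lambda>r. r div 2" and j = "\<lambda>k. 2 * k"])
    (auto simp: mult_ac)

text \<open>The triples are grouped by the lattice index \<open>m = p * r\<close>: the factor
  \<open>l\<close> is even exactly when \<open>2 * m\<close> divides \<open>n\<close>, and summing
  \<open>p\<close> over the divisors of \<open>m\<close> gives \<open>sigma1 m\<close>.\<close>

lemma sum_Z3_eq:
  assumes "n > 0"
  shows "(\<Sum>(l, p, r)\<in>factor_triples n. if even l then p * (p * r) else 0) =
    (\<Sum>m | 2 * m dvd n. sigma1 m * m)"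
proof -
  have pos: "m > 0" if "2 * m dvd n" for m
    using that assms by (auto elim!: dvdE)
  have fin: "finite {m. 2 * m dvd n}"
    by (rule finite_subset[of _ "{..n}"]) (use assms in \<open>auto dest!: dvd_mult_right intro: dvd_imp_le\<close>)
  have "(\<Sum>m | 2 * m dvd n. sigma1 m * m) = (\<Sum>m | 2 * m dvd n. \<Sum>p | p dvd m. p * m)"
    by (simp add: sigma1_def sum_distrib_right)
  also have "\<dots> = (\<Sum>(m, p)\<in>(SIGMA m:{m. 2 * m dvd n}. {p. p dvd m}). p * m)"
    by (rule sum.Sigma[OF fin]) (use pos in \<open>auto intro: finite_divisors_nat\<close>)
  also have "\<dots> = (\<Sum>(l, p, r)\<in>{t \<in> factor_triples n. even (fst t)}. p * (p * r))"
  proof (rule sum.reindex_bij_witness[where i = "\<lambda>(l, p, r). (p * r, p)"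
        and j = "\<lambda>(m, p). (n div m, p, m div p)"])
    fix s assume "s \<in> (SIGMA m:{m. 2 * m dvd n}. {p. p dvd m})"
    then obtain k p j where s: "s = (p * j, p)" "n = 2 * (p * j) * k"
      by (auto elim!: dvdE)
    then have "p > 0" "j > 0"
      using assms by auto
    then have "n div (p * j) = 2 * k"
      using s(2) by simp
    then have j: "(case s of (m, p) \<Rightarrow> (n div m, p, m div p)) = (2 * k, p, j)"
      using \<open>p > 0\<close> by (simp add: s(1))
    show "(case s of (m, p) \<Rightarrow> (n div m, p, m div p)) \<in> {t \<in> factor_triples n. even (fst t)}"
      unfolding j by (simp add: factor_triples_def s(2) mult_ac)
    show "(case case s of (m, p) \<Rightarrow> (n div m, p, m div p) of (l, p, r) \<Rightarrow> (p * r, p)) = s"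
      unfolding j by (simp add: s(1))
    show "(case case s of (m, p) \<Rightarrow> (n div m, p, m div p) of (l, p, r) \<Rightarrow> p * (p * r)) =
        (case s of (m, p) \<Rightarrow> p * m)"
      unfolding j by (simp add: s(1))
  next
    fix t assume t: "t \<in> {t \<in> factor_triples n. even (fst t)}"
    obtain l p r where lpr: "t = (l, p, r)"
      by (cases t)
    with t obtain k where "l = 2 * k"
      by (auto elim: evenE)
    with t lpr have *: "t = (2 * k, p, r)" "n = 2 * k * p * r"
      by (auto simp: factor_triples_def)
    then have "p > 0" "r > 0"
      using assms by auto
    moreover have n_eq: "n = 2 * k * (p * r)"
      by (simp add: *(2) mult_ac)
    ultimately show "(case case t of (l, p, r) \<Rightarrow> (p * r, p) of (m, p) \<Rightarrow> (n div m, p, m div p)) = t"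
      by (simp add: *(1))
    show "(case t of (l, p, r) \<Rightarrow> (p * r, p)) \<in> (SIGMA m:{m. 2 * m dvd n}. {p. p dvd m})"
      by (simp add: *(1) n_eq mult_ac)
  qed
  also have "\<dots> = (\<Sum>(l, p, r)\<in>factor_triples n. if even l then p * (p * r) else 0)"
    by (subst sum.inter_filter[OF finite_factor_triples[OF assms]])
      (rule sum.cong, auto split: prod.split)
  finally show ?thesis by simp
qed

text \<open>In \<open>4 * k = 2 * (2 * k)\<close> the outer 2 makes \<open>l\<close> even, and
  \<open>2 * k\<close> is the even factor \<open>r\<close>.\<close>

lemma sum_sigma1_quarter:
  assumes "n > 0"
  shows "(\<Sum>k | 4 * k dvd n. 2 * k * sigma1 (n div (4 * k))) =
    (\<Sum>(l, p, r)\<in>factor_triples n. if even l \<and> even r then p * r else 0)"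
  using sum_even_reindex[where c = 2 and n = n and f = "\<lambda>r. r * sigma1 (n div (2 * r))"] sigma1_sum_eq_triples[OF assms, of 2 even]
  by simp

text \<open>The triples with even \<open>r\<close> are split by the parity of \<open>l\<close>. The
  additive form avoids truncated subtraction on natural numbers.\<close>

lemma sum_amph_0_eq:
  assumes "n > 0"
  shows "(\<Sum>(l, p, r)\<in>factor_triples n. if odd l \<and> even r then p * r else 0) +
      (\<Sum>k | 4 * k dvd n. 2 * k * sigma1 (n div (4 * k))) =
    (\<Sum>k | 2 * k dvd n. 2 * k * sigma1 (n div (2 * k)))"
proof -
  have "(\<Sum>k | 2 * k dvd n. 2 * k * sigma1 (n div (2 * k))) =
      (\<Sum>(l, p, r)\<in>factor_triples n. if even r then p * r else 0)"
    using sum_even_reindex[where c = 1 and n = n and f = "\<lambda>r. r * sigma1 (n div r)"] sigma1_sum_eq_triples[OF assms, of 1 even]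
    by simp
  then show ?thesis
    unfolding sum_sigma1_quarter[OF assms]
    by (simp only: sum.distrib[symmetric]) (rule sum.cong, auto)
qed

text \<open>All factors of an odd \<open>n\<close> are odd, so the parity condition holds for every
  triple.\<close>

lemma sum_amph_1_odd_eq:
  assumes "odd n"
  shows "(\<Sum>(l, p, r)\<in>factor_triples n. if odd l \<and> even (r + p) then p * r else 0) =
    (\<Sum>k | k dvd n. sigma1 (n div k) * k)"
proof -
  have n: "n > 0"
    using assms by (rule odd_pos)
  have "(\<Sum>k | k dvd n. sigma1 (n div k) * k) = (\<Sum>(l, p, r)\<in>factor_triples n. p * r)"
    using sigma1_sum_eq_triples[OF n, of 1 "\<lambda>_. True"] by (simp add: mult.commute)
  also have "\<dots> = (\<Sum>(l, p, r)\<in>factor_triples n. if odd l \<and> even (r + p) then p * r else 0)"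
    by (rule sum.cong) (use assms in \<open>auto simp: factor_triples_def\<close>)
  finally show ?thesis by simp
qed

text \<open>With \<open>r = 2 * k\<close>, the right side runs over triples with \<open>r\<close>
  and \<open>l * p\<close> even. Those with even \<open>l\<close> form the second sum on the left.
  Those with odd \<open>l\<close> have \<open>p\<close> and \<open>r\<close> both even, which for
  even \<open>n\<close> is the same as \<open>r + p\<close> being even.\<close>

lemma sum_amph_1_even_eq:
  assumes "n > 0" "even n"
  shows "(\<Sum>(l, p, r)\<in>factor_triples n. if odd l \<and> even (r + p) then p * r else 0) +
      (\<Sum>k | 4 * k dvd n. 2 * k * sigma1 (n div (4 * k))) =
    (\<Sum>k | 4 * k dvd n. 2 * k * sigma1 (n div (2 * k)))"
proof -
  have "(\<Sum>k | 4 * k dvd n. 2 * k * sigma1 (n div (2 * k))) =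
      (\<Sum>r | 1 * r dvd n \<and> 2 * r dvd n \<and> even r. r * sigma1 (n div (1 * r)))"
    by (rule sum.reindex_bij_witness[where i = "\<lambda>r. r div 2" and j = "\<lambda>k. 2 * k"])
      (auto intro: dvd_mult_right)
  also have "\<dots> = (\<Sum>(l, p, r)\<in>factor_triples n. if 1 dvd l \<and> 2 * r dvd n \<and> even r then p * r else 0)"
    by (rule sigma1_sum_eq_triples[OF assms(1)]) simp
  also have "\<dots> = (\<Sum>(l, p, r)\<in>factor_triples n.
      (if odd l \<and> even (r + p) then p * r else 0) + (if even l \<and> even r then p * r else 0))"
  proof (rule sum.cong[OF HOL.refl])
    fix t assume t: "t \<in> factor_triples n"
    obtain l p r where lpr: "t = (l, p, r)"
      by (cases t)
    have n: "n = l * p * r" and "r > 0"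
      using t factor_triples_pos(3)[of l p r n] assms(1) by (simp_all add: lpr factor_triples_def)
    then have "2 * r dvd n \<longleftrightarrow> even (l * p)"
      by simp
    moreover have "even (l * p * r)"
      using assms(2) n by simp
    ultimately show "(case t of (l, p, r) \<Rightarrow> if 1 dvd l \<and> 2 * r dvd n \<and> even r then p * r else 0) =
        (case t of (l, p, r) \<Rightarrow>
          (if odd l \<and> even (r + p) then p * r else 0) + (if even l \<and> even r then p * r else 0))"
      by (auto simp: lpr)
  qed
  finally show ?thesis
    unfolding sum_sigma1_quarter[OF assms(1)]
    by (simp add: sum.distrib[symmetric] split_beta)
qed

section \<open>Classification and counts for the presented groups\<close>

theorem theorem4:
  fixes n :: nat
  assumes "n > 0"
  shows "(\<forall>\<Delta> \<in> subgroups_of_index pi1_B2 n.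
            pi1_B2\<lparr>carrier := \<Delta>\<rparr> \<cong> Z3 \<or>
            pi1_B2\<lparr>carrier := \<Delta>\<rparr> \<cong> pi1_B2 \<or>
            pi1_B2\<lparr>carrier := \<Delta>\<rparr> \<cong> pi1_B1) \<and>
         finite (subgroups_of_index pi1_B2 n) \<and>
         num_subgroups Z3 pi1_B2 n = (\<Sum>l | 2 * l dvd n. sigma1 l * l) \<and>
         int (num_subgroups pi1_B2 pi1_B2 n) =
           (if even n
            then (\<Sum>k | 4 * k dvd n.
                    2 * int k * (int (sigma1 (n div (2 * k))) - int (sigma1 (n div (4 * k)))))
            else (\<Sum>k | k dvd n. int (sigma1 (n div k)) * int k)) \<and>
         int (num_subgroups pi1_B1 pi1_B2 n) =
           (\<Sum>k | 2 * k dvd n. 2 * int k * int (sigma1 (n div (2 * k)))) -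
           (\<Sum>k | 4 * k dvd n. 2 * int k * int (sigma1 (n div (4 * k))))"
proof -
  have groups: "group pi1_B1" "group pi1_B2"
    by (simp_all add: pi1_B1_def pi1_B2_def group_presented_group)
  obtain f where f: "f \<in> iso (amph 1) pi1_B2"
    using amph_1_iso_pi1_B2 by (auto simp: is_iso_def)
  have bij: "bij_betw ((`) f) (subgroups_of_index (amph 1) n) (subgroups_of_index pi1_B2 n)"
    by (rule iso_bij_betw_subgroups_of_index[OF f group_amph groups(2)])
  note bij' = bij_betw_param_subgroup[OF assms]
  have types: "pi1_B2\<lparr>carrier := \<Delta>\<rparr> \<cong> Z3 \<or> pi1_B2\<lparr>carrier := \<Delta>\<rparr> \<cong> pi1_B2 \<or>
      pi1_B2\<lparr>carrier := \<Delta>\<rparr> \<cong> pi1_B1" if "\<Delta> \<in> subgroups_of_index pi1_B2 n" for \<Delta>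
  proof -
    have "\<Delta> \<in> (`) f ` param_subgroup ` Sigma (factor_triples n) lattice_residues"
      using that bij bij' by (simp add: bij_betw_def)
    then obtain t where t: "t \<in> Sigma (factor_triples n) lattice_residues" "\<Delta> = f ` param_subgroup t"
      by blast
    obtain l p r q a b where t_eq: "t = ((l, p, r), (q, a, b))"
      by (metis surj_pair)
    let ?H = "(amph 1)\<lparr>carrier := param_subgroup t\<rparr>"
    have mem: "param_subgroup t \<in> subgroups_of_index (amph 1) n"
      using t(1) bij' by (auto simp: bij_betw_def)
    have "?H \<cong> pi1_B2\<lparr>carrier := \<Delta>\<rparr>"
      unfolding t(2) by (rule iso_restrict[OF f]) simp
    then have iso: "pi1_B2\<lparr>carrier := \<Delta>\<rparr> \<cong> ?H"
      by (rule group.iso_sym[OF group_subgroups_of_index[OF group_amph mem]])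
    let ?e = "(int r - 2 * int q) div int p mod 2"
    \<comment> \<open>For odd \<open>l\<close> the parity \<open>?e\<close> decides which reflection
      acts on the lattice, and hence which amphicosm group arises.\<close>
    consider "even l" | "odd l" "?e = 0" | "odd l" "?e = 1"
      by linarith
    then show ?thesis
    proof cases
      case 1
      then have "?H \<cong> Z3"
        using param_subgroup_type(1)[OF assms t(1)[unfolded t_eq]] by (simp add: t_eq)
      then show ?thesis
        using iso_trans[OF iso] by blast
    next
      case 2
      then have "?H \<cong> amph 0"
        using param_subgroup_type(2)[OF assms t(1)[unfolded t_eq]] by (simp add: t_eq)
      then show ?thesis
        using iso_trans[OF iso] iso_trans[OF _ amph_0_iso_pi1_B1] by blast
    next
      case 3
      then have "?H \<cong> amph 1"
        using param_subgroup_type(2)[OF assms t(1)[unfolded t_eq]] by (simp add: t_eq)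
      then show ?thesis
        using iso_trans[OF iso] iso_trans[OF _ amph_1_iso_pi1_B2] by blast
    qed
  qed
  have "finite (Sigma (factor_triples n) lattice_residues)"
    by (rule finite_SigmaI[OF finite_factor_triples[OF assms]]) (auto simp: lattice_residues_def)
  then have finite: "finite (subgroups_of_index pi1_B2 n)"
    using bij_betw_finite[OF bij] bij_betw_finite[OF bij'] by blast
  have num_Z3: "num_subgroups Z3 pi1_B2 n = (\<Sum>l | 2 * l dvd n. sigma1 l * l)"
    using num_subgroups_cong[OF iso_refl amph_1_iso_pi1_B2 group_Z3 group_amph groups(2), of n]
      num_subgroups_Z3_amph_1[OF assms] sum_Z3_eq[OF assms]
    by simp
  have num_B2: "num_subgroups pi1_B2 pi1_B2 n =
      (\<Sum>(l, p, r)\<in>factor_triples n. if odd l \<and> even (r + p) then p * r else 0)"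
    using num_subgroups_cong[OF amph_1_iso_pi1_B2 amph_1_iso_pi1_B2 group_amph group_amph groups(2), of n]
      num_subgroups_amph_amph_1[OF assms, of 1]
    by simp
  have num_B1: "num_subgroups pi1_B1 pi1_B2 n =
      (\<Sum>(l, p, r)\<in>factor_triples n. if odd l \<and> even r then p * r else 0)"
    using num_subgroups_cong[OF amph_0_iso_pi1_B1 amph_1_iso_pi1_B2 group_amph group_amph groups(2), of n]
      num_subgroups_amph_amph_1[OF assms, of 0]
    by simp
  have quarter: "int (\<Sum>k | 4 * k dvd n. 2 * k * sigma1 (n div (4 * k))) =
      (\<Sum>k | 4 * k dvd n. 2 * int k * int (sigma1 (n div (4 * k))))"
    by simp
  \<comment> \<open>The additive identity over the naturals is cast to the integers, where the
    quarter sum can be moved to the other side.\<close>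
  have B1: "int (num_subgroups pi1_B1 pi1_B2 n) =
      (\<Sum>k | 2 * k dvd n. 2 * int k * int (sigma1 (n div (2 * k)))) -
      (\<Sum>k | 4 * k dvd n. 2 * int k * int (sigma1 (n div (4 * k))))"
    using arg_cong[OF sum_amph_0_eq[OF assms], of int] quarter
    unfolding num_B1 by simp
  have B2: "int (num_subgroups pi1_B2 pi1_B2 n) =
      (if even n
       then (\<Sum>k | 4 * k dvd n.
               2 * int k * (int (sigma1 (n div (2 * k))) - int (sigma1 (n div (4 * k)))))
       else (\<Sum>k | k dvd n. int (sigma1 (n div k)) * int k))"
  proof (cases "even n")
    case True
    then show ?thesis
      using arg_cong[OF sum_amph_1_even_eq[OF assms True], of int] quarter
      unfolding num_B2 by (simp add: right_diff_distrib sum_subtractf)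
  next
    case False
    then show ?thesis
      unfolding num_B2 sum_amph_1_odd_eq[OF False] by simp
  qed
  show ?thesis
    using types finite num_Z3 B1 B2 by blast
qed

end
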